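(* Let $p$ be a prime number, let $e\geq 1$ be an integer, and assume that $q=p^e$ is at least $7$. Then the group $\mathrm{PSL}(2,q)$ admits an unmixed Beauville structure.
   Context: $\mathrm{PSL}(2,q)$ denotes the quotient of the group $\mathrm{SL}(2,q)$ of $2\times 2$ matrices of determinant $1$ over the finite field with $q$ elements by its center. An unmixed Beauville structure for a finite group $G$ is a quadruple $(x_1,y_1;x_2,y_2)$ of elements of $G$ such that, setting $z_i:=(x_iy_i)^{-1}$ and $T_i:=(x_i,y_i,z_i)$ for $i=1,2$ (so that $x_iy_iz_i=1$), one has: (a) $\langle x_i,y_i\rangle=G$ for $i=1,2$; (b) $\Sigma(T_1)\cap\Sigma(T_2)=\{1\}$, where $$\Sigma(T_i):=\bigcup_{g\in G}\bigcup_{j=1}^{\infty}\{gx_i^jg^{-1},\,gy_i^jg^{-1},\,gz_i^jg^{-1}\}.$$ *)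

theory Defs
  imports
    "HOL-Analysis.Analysis"
    "HOL-Algebra.Coset"
    "HOL-Algebra.Generated_Groups"
begin

definition group_center :: "('g, 'm) monoid_scheme \<Rightarrow> 'g set" where
  "group_center G = {z \<in> carrier G. \<forall>g \<in> carrier G. g \<otimes>\<^bsub>G\<^esub> z = z \<otimes>\<^bsub>G\<^esub> g}"

lemma (in group) group_center_normal: "group_center G \<lhd> G"
proof -
  have inv_comm: "g \<otimes> inv z = inv z \<otimes> g"
    if z: "z \<in> group_center G" and g: "g \<in> carrier G" for z g
  proof -
    have zc: "z \<in> carrier G" and c: "g \<otimes> z = z \<otimes> g"
      using z g by (auto simp: group_center_def)
    have "z \<otimes> (g \<otimes> inv z) = (z \<otimes> g) \<otimes> inv z"
      using zc g by (simp add: m_assoc)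
    also have "\<dots> = g \<otimes> (z \<otimes> inv z)"
      using zc g by (simp add: m_assoc flip: c)
    finally have "z \<otimes> (g \<otimes> inv z) = g"
      using zc g by simp
    then show ?thesis
      using zc g inv_solve_left[of g "g \<otimes> inv z" z] inv_solve_left'[of "g \<otimes> inv z" z g] by simp
  qed
  have "subgroup (group_center G) G"
  proof (rule subgroupI)
    show "group_center G \<subseteq> carrier G" by (auto simp: group_center_def)
    show "group_center G \<noteq> {}" by (auto simp: group_center_def intro!: exI[of _ \<one>])
    show "inv z \<in> group_center G" if "z \<in> group_center G" for z
      using inv_comm[OF that] that by (auto simp: group_center_def)
    show "y \<otimes> z \<in> group_center G"
      if "y \<in> group_center G" "z \<in> group_center G" for y z
    proof -
      have c: "y \<in> carrier G" "z \<in> carrier G" using that by (auto simp: group_center_def)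
      have "g \<otimes> (y \<otimes> z) = (y \<otimes> z) \<otimes> g" if g: "g \<in> carrier G" for g
      proof -
        have "g \<otimes> (y \<otimes> z) = (g \<otimes> y) \<otimes> z" using c g by (simp add: m_assoc)
        also have "g \<otimes> y = y \<otimes> g"
          using \<open>y \<in> group_center G\<close> g by (simp add: group_center_def)
        also have "(y \<otimes> g) \<otimes> z = y \<otimes> (g \<otimes> z)" using c g by (simp add: m_assoc)
        also have "g \<otimes> z = z \<otimes> g"
          using \<open>z \<in> group_center G\<close> g by (simp add: group_center_def)
        also have "y \<otimes> (z \<otimes> g) = (y \<otimes> z) \<otimes> g" using c g by (simp add: m_assoc)
        finally show ?thesis .
      qed
      with c show ?thesis by (simp add: group_center_def)
    qed
  qed
  moreover have "x \<otimes> h \<otimes> inv x \<in> group_center G"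
    if "x \<in> carrier G" "h \<in> group_center G" for x h
  proof -
    have h: "h \<in> carrier G" and c: "x \<otimes> h = h \<otimes> x"
      using that by (auto simp: group_center_def)
    then have "x \<otimes> h \<otimes> inv x = h"
      using that(1) by (simp add: m_assoc)
    with that(2) show ?thesis by simp
  qed
  ultimately show ?thesis
    by (simp add: normal_inv_iff)
qed

text \<open>The underlying field is the type \<open>'a\<close>, fixed by a type annotation at each use;
  \<open>SL(2,q)\<close> is the instance with \<open>CARD('a) = q\<close>.\<close>

definition SL2 :: "('a::field ^ 2 ^ 2) monoid" where
  "SL2 = \<lparr>carrier = {A. det A = 1}, monoid.mult = (**), one = mat 1\<rparr>"

lemma group_SL2: "group (SL2 :: ('a::field ^ 2 ^ 2) monoid)"
proof (rule groupI)
  fix A :: "'a ^ 2 ^ 2"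
  assume "A \<in> carrier SL2"
  then have d: "det A = 1" by (simp add: SL2_def)
  then have "invertible A" by (simp add: invertible_det_nz)
  then obtain B where B: "B ** A = mat 1" by (auto simp: invertible_def)
  then have "det B * det A = 1" by (metis det_I det_mul)
  with d B show "\<exists>B \<in> carrier SL2. B \<otimes>\<^bsub>SL2\<^esub> A = \<one>\<^bsub>SL2\<^esub>"
    by (auto simp: SL2_def)
qed (auto simp: SL2_def det_mul matrix_mul_assoc)

definition PSL2 :: "('a::field ^ 2 ^ 2) set monoid" where
  "PSL2 = SL2 Mod group_center SL2"

lemma group_PSL2: "group PSL2"
  unfolding PSL2_def
  by (intro normal.factorgroup_is_group group.group_center_normal group_SL2)

lemma finite_PSL2: "finite (carrier (PSL2 :: ('a::{field,finite} ^ 2 ^ 2) set monoid))"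
  by simp

definition beauville_Sigma :: "('g, 'm) monoid_scheme \<Rightarrow> 'g \<Rightarrow> 'g \<Rightarrow> 'g set" where
  "beauville_Sigma G x y =
    (let z = inv\<^bsub>G\<^esub> (x \<otimes>\<^bsub>G\<^esub> y) in
      \<Union>g \<in> carrier G. \<Union>j \<in> {1::nat..}.
        {g \<otimes>\<^bsub>G\<^esub> (x [^]\<^bsub>G\<^esub> j) \<otimes>\<^bsub>G\<^esub> inv\<^bsub>G\<^esub> g,
         g \<otimes>\<^bsub>G\<^esub> (y [^]\<^bsub>G\<^esub> j) \<otimes>\<^bsub>G\<^esub> inv\<^bsub>G\<^esub> g,
         g \<otimes>\<^bsub>G\<^esub> (z [^]\<^bsub>G\<^esub> j) \<otimes>\<^bsub>G\<^esub> inv\<^bsub>G\<^esub> g})"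

definition unmixed_beauville_structure ::
    "('g, 'm) monoid_scheme \<Rightarrow> 'g \<Rightarrow> 'g \<Rightarrow> 'g \<Rightarrow> 'g \<Rightarrow> bool" where
  "unmixed_beauville_structure G x1 y1 x2 y2 \<longleftrightarrow>
    {x1, y1, x2, y2} \<subseteq> carrier G \<and>
    generate G {x1, y1} = carrier G \<and>
    generate G {x2, y2} = carrier G \<and>
    beauville_Sigma G x1 y1 \<inter> beauville_Sigma G x2 y2 = {\<one>\<^bsub>G\<^esub>}"

end

theory Submission
  imports Defs "HOL-Number_Theory.Residues"
begin

text \<open>
  Disjointness is decided by traces. If a power of \<open>X\<close> agrees up to the centre with a
  conjugate of a power of \<open>W\<close>, and this power is not scalar, then that conjugate of \<open>W\<close>
  commutes with a nonscalar matrix that \<open>X\<close> commutes with too, so it equals \<open>u + v X\<close>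
  with \<open>v \<noteq> 0\<close>. Hence \<open>X\<close> and \<open>W\<close> have equally
  many distinct eigenvalues in the field.

  For \<open>q > 7\<close> let \<open>l\<close> be a primitive root and \<open>x = diag(l, 1/l)\<close>. The first triple consists of
  \<open>x\<close> and a matrix chosen so that all three traces are \<open>l + 1/l\<close> up to sign; all three elements
  are then diagonalisable with distinct eigenvalues. The second is \<open>(Y, x Y)\<close> with
  \<open>tr Y \<cdot> tr (x Y) = l + 1/l + 2\<close>, which makes the trace of \<open>Y x Y\<close> equal to \<open>2\<close>; by counting,
  \<open>tr Y\<close> and \<open>tr (x Y)\<close> can both be chosen outside the set of traces of such diagonalisable
  elements. Both pairs generate a subgroup that contains the whole diagonal torus, and it contains
  a nontrivial unipotent as soon as a suitable product has a single vanishing diagonal entry.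
  For \<open>q = 7\<close> the first recipe yields a triangular matrix, and a nonsplit triple and a pair of
  unipotent generators take its place.
\<close>

section \<open>Finite fields\<close>

definition primitive_root :: "'a::field \<Rightarrow> bool" where
  "primitive_root l \<longleftrightarrow> l \<noteq> 0 \<and> (\<forall>x. x \<noteq> 0 \<longrightarrow> (\<exists>k::nat. x = l ^ k))"

text \<open>The multiplicative group of a finite field is cyclic. The type-class field is repackaged
  as a record with carrier \<open>UNIV\<close> so that this fact can be applied.\<close>

lemma ex_primitive_root: "\<exists>l :: 'a::{field,finite}. primitive_root l"
proof -
  let ?R = "\<lparr>carrier = (UNIV :: 'a set), monoid.mult = (*), one = 1, zero = 0, add = (+)\<rparr>"
  have neg: "\<exists>y. x + y = 0" for x :: 'a
    by (rule exI[of _ "- x"]) simp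
  have cr: "cring ?R"
    by (rule cringI)
      (auto intro!: abelian_groupI comm_monoidI neg simp: algebra_simps)
  have fld: "field ?R"
    by (rule cring.cring_fieldI2[OF cr]) (auto intro: exI[of _ "inverse _"] right_inverse)
  then interpret R: field ?R .
  have fin: "finite (carrier ?R)" by simp
  have pow: "l [^]\<^bsub>?R\<^esub> (i::nat) = l ^ i" for l i
    by (induction i) (auto simp: nat_pow_def mult.commute)
  have "\<exists>l \<in> carrier (mult_of ?R). UNIV - {0} = {l ^ i | i::nat. i \<in> UNIV}"
    using R.finite_field_mult_group_has_gen[OF fin] unfolding pow by simp
  then obtain l where l: "l \<in> carrier (mult_of ?R)"
    and gen: "UNIV - {0} = {l ^ i | i::nat. i \<in> UNIV}" by blast
  from l have "l \<noteq> 0" by simp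
  moreover have "\<exists>k::nat. x = l ^ k" if "x \<noteq> 0" for x
  proof -
    from that have "x \<in> UNIV - {0}" by simp
    then show ?thesis unfolding gen by blast
  qed
  ultimately show ?thesis
    unfolding primitive_root_def by blast
qed

text \<open>Reducing exponents modulo \<open>n\<close> shows that the powers with exponent below
  \<open>n\<close> already exhaust the nonzero elements.\<close>

lemma card_le_if_primitive_root_power_eq_1:
  fixes l :: "'a::{field,finite}"
  assumes "primitive_root l" and "l ^ n = 1" and "n > 0"
  shows "CARD('a) - 1 \<le> n"
proof -
  have "UNIV - {0} \<subseteq> (\<lambda>i. l ^ i) ` {..<n}"
  proof
    fix x :: 'a assume "x \<in> UNIV - {0}"
    then obtain k where x: "x = l ^ k"
      using assms(1) by (auto simp: primitive_root_def)
    have "l ^ k = l ^ (n * (k div n) + k mod n)" by simp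
    also have "\<dots> = l ^ (k mod n)"
      using assms(2) by (simp only: power_add power_mult power_one mult_1)
    finally show "x \<in> (\<lambda>i. l ^ i) ` {..<n}"
      using x assms(3) by auto
  qed
  then have "card (UNIV - {0::'a}) \<le> card ((\<lambda>i. l ^ i) ` {..<n})"
    by (intro card_mono) auto
  also have "\<dots> \<le> n" using card_image_le[of "{..<n}" "\<lambda>i. l ^ i"] by simp
  finally show ?thesis by (simp add: card_Diff_singleton)
qed

text \<open>Pigeonhole: the exponents \<open>0\<close> to \<open>?n\<close> outnumber the nonzero
  elements, so two powers coincide. Their exponents differ by at most \<open>?n\<close>, and by the
  previous bound by at least \<open>?n\<close>.\<close>

lemma primitive_root_power_card:
  fixes l :: "'a::{field,finite}"
  assumes l: "primitive_root l"
  shows "l ^ (CARD('a) - 1) = 1"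
proof -
  let ?n = "CARD('a) - 1"
  have nz: "l \<noteq> 0" using l by (simp add: primitive_root_def)
  have "\<not> inj_on (\<lambda>i. l ^ i) {..?n}"
  proof
    assume "inj_on (\<lambda>i. l ^ i) {..?n}"
    then have "card ((\<lambda>i. l ^ i) ` {..?n}) = Suc ?n" by (simp add: card_image)
    moreover have "card ((\<lambda>i. l ^ i) ` {..?n}) \<le> card (UNIV - {0::'a})"
      using nz by (intro card_mono) auto
    ultimately show False by (simp add: card_Diff_singleton)
  qed
  then obtain i j where ij: "i < j" "j \<le> ?n" "l ^ i = l ^ j"
    by (auto simp: inj_on_def) (metis linorder_neqE_nat)
  then have "l ^ i * l ^ (j - i) = l ^ i * 1"
    by (metis le_add_diff_inverse less_imp_le mult_1_right power_add)
  then have eq: "l ^ (j - i) = 1" using nz by simp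
  with card_le_if_primitive_root_power_eq_1[OF l eq] ij have "j - i = ?n" by simp
  with eq show ?thesis by simp
qed

text \<open>In characteristic 2 squaring is injective, hence onto; otherwise a difference of squares
  factors. Torus conjugation scales unipotents by squares only, and this fact fills the gap to
  arbitrary entries.\<close>

lemma ex_diff_of_squares:
  fixes x :: "'a::{field,finite}"
  shows "\<exists>u v. x = u ^ 2 - v ^ 2"
proof (cases "(2::'a) = 0")
  case True
  have "inj (\<lambda>u::'a. u ^ 2)"
  proof (rule injI)
    fix u v :: 'a assume "u ^ 2 = v ^ 2"
    then have "(u - v) ^ 2 = 2 * (v ^ 2 - u * v)"
      by (simp add: power2_eq_square algebra_simps)
    then show "u = v" using True by simp
  qed
  then have "surj (\<lambda>u::'a. u ^ 2)" by (simp add: finite_UNIV_inj_surj)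
  then obtain u where "x = u ^ 2" by (meson surjD)
  then show ?thesis by (intro exI[of _ u] exI[of _ 0]) simp
next
  case False
  have "((x + 1) / 2) ^ 2 - ((x - 1) / 2) ^ 2
      = ((x + 1) / 2 - (x - 1) / 2) * ((x + 1) / 2 + (x - 1) / 2)"
    by (simp add: power2_eq_square algebra_simps)
  also have "\<dots> = x"
    using False by (simp flip: add_divide_distrib diff_divide_distrib)
  finally have "x = ((x + 1) / 2) ^ 2 - ((x - 1) / 2) ^ 2" ..
  then show ?thesis by blast
qed

section \<open>Two by two matrices\<close>

definition mat2 :: "'a::field \<Rightarrow> 'a \<Rightarrow> 'a \<Rightarrow> 'a \<Rightarrow> 'a ^ 2 ^ 2" where
  "mat2 a b c d = vector [vector [a, b], vector [c, d]]"

lemma mat2_nth [simp]: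
  "mat2 a b c d $ 1 $ 1 = a" "mat2 a b c d $ 1 $ 2 = b"
  "mat2 a b c d $ 2 $ 1 = c" "mat2 a b c d $ 2 $ 2 = d"
  by (auto simp: mat2_def)

lemma mat2_mult [simp]:
  "mat2 a b c d ** mat2 a' b' c' d' =
    mat2 (a * a' + b * c') (a * b' + b * d') (c * a' + d * c') (c * b' + d * d')"
  by (simp add: vec_eq_iff matrix_matrix_mult_def forall_2 sum_2)

lemma det_mat2 [simp]: "det (mat2 a b c d) = a * d - b * c"
  by (simp add: det_2)

lemma mat2_inject [simp]:
  "mat2 a b c d = mat2 a' b' c' d' \<longleftrightarrow> a = a' \<and> b = b' \<and> c = c' \<and> d = d'"
  by (auto simp: vec_eq_iff forall_2)

lemma mat2_cases: obtains a b c d where "A = mat2 a b c d"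
  by (rule that[of "A$1$1" "A$1$2" "A$2$1" "A$2$2"]) (simp add: vec_eq_iff forall_2)

lemma mat_1_eq_mat2: "mat 1 = mat2 1 0 0 1"
  by (simp add: vec_eq_iff forall_2 mat_def)

lemma mat2_in_SL2 [simp]: "mat2 a b c d \<in> carrier SL2 \<longleftrightarrow> a * d - b * c = 1"
  by (simp add: SL2_def)

lemma mult_SL2 [simp]: "A \<otimes>\<^bsub>SL2\<^esub> B = A ** B"
  by (simp add: SL2_def)

lemma one_SL2: "\<one>\<^bsub>SL2\<^esub> = mat2 1 0 0 1"
  by (simp add: SL2_def mat_1_eq_mat2)

lemma inv_SL2:
  assumes "a * d - b * c = 1"
  shows "inv\<^bsub>SL2\<^esub> (mat2 a b c d) = mat2 d (- b) (- c) a"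
  by (rule group.inv_equality[OF group_SL2])
    (use assms in \<open>auto simp: one_SL2 algebra_simps\<close>)

section \<open>Subgroups containing the diagonal torus\<close>

locale torus_subgroup =
  fixes H :: "('a::{field,finite} ^ 2 ^ 2) set"
  assumes sub: "subgroup H SL2"
    and diag: "\<And>r. r \<noteq> 0 \<Longrightarrow> mat2 r 0 0 (1 / r) \<in> H"
begin

lemma det_eq_1: "mat2 a b c d \<in> H \<Longrightarrow> a * d - b * c = 1"
  using subgroup.subset[OF sub] by (auto simp: SL2_def)

lemma mult_mem: "A \<in> H \<Longrightarrow> B \<in> H \<Longrightarrow> A ** B \<in> H"
  using subgroup.m_closed[OF sub] by fastforce

lemma inv_mem: "mat2 a b c d \<in> H \<Longrightarrow> mat2 d (- b) (- c) a \<in> H"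
  using subgroup.m_inv_closed[OF sub, of "mat2 a b c d"] inv_SL2 det_eq_1 by metis

lemma lower_unipotent_mem:
  assumes b: "mat2 1 0 b 1 \<in> H" "b \<noteq> 0"
  shows "mat2 1 0 x 1 \<in> H"
proof -
  \<comment> \<open>Conjugation by \<open>diag(u, 1/u)\<close> multiplies the lower left entry by a
    square.\<close>
  have sq: "mat2 1 0 (b * u ^ 2) 1 \<in> H" for u
  proof (cases "u = 0")
    case True
    then show ?thesis using diag[of 1] by simp
  next
    case False
    then have "mat2 (1 / u) 0 0 (1 / (1 / u)) ** (mat2 1 0 b 1 ** mat2 u 0 0 (1 / u)) \<in> H"
      by (intro mult_mem b diag) auto
    then show ?thesis using False by (simp add: power2_eq_square mult_ac)
  qed
  obtain u v where uv: "x / b = u ^ 2 - v ^ 2" using ex_diff_of_squares by blast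
  have "mat2 1 0 (b * u ^ 2) 1 ** mat2 1 (- 0) (- (b * v ^ 2)) 1 \<in> H"
    by (intro mult_mem inv_mem sq)
  moreover have "b * u ^ 2 - b * v ^ 2 = x"
    using uv b(2) by (simp add: field_simps)
  ultimately show ?thesis by simp
qed

text \<open>A matrix with nonzero upper right entry arises from \<open>Y\<close> by a torus factor
  and lower unipotents on both sides. If that entry is zero, multiplying by \<open>Y\<close> leads
  back to this case.\<close>

lemma eq_SL2_if_lower_unipotent:
  assumes lo: "\<And>x. mat2 1 0 x 1 \<in> H" and Y: "mat2 a b c d \<in> H" "b \<noteq> 0"
  shows "H = carrier SL2"
proof -
  have gen: "mat2 p q r s \<in> H" if det: "p * s - q * r = 1" and "q \<noteq> 0" for p q r s
  proof -
    \<comment> \<open>The torus factor adjusts the upper right entry, the unipotent with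
      \<open>v\<close> the upper left one. The lower row is arbitrary at first and is corrected by
      \<open>u\<close> below; the determinant then forces \<open>r\<close>.\<close>
    define k where "k = q / b"
    have k: "k \<noteq> 0" using that Y by (simp add: k_def)
    define v where "v = (p - k * a) / q"
    have "mat2 k 0 0 (1 / k) ** (mat2 a b c d ** mat2 1 0 v 1) \<in> H"
      by (intro mult_mem lo Y diag k)
    moreover have "k * (a + b * v) = p" "k * b = q"
      using that Y by (auto simp: k_def v_def field_simps)
    ultimately obtain r' s' where M: "mat2 p q r' s' \<in> H" by auto
    then have det': "p * s' - q * r' = 1" by (rule det_eq_1)
    define u where "u = (s - s') / q"
    have s: "s' + u * q = s" using \<open>q \<noteq> 0\<close> by (simp add: u_def)
    have "q * (r' + u * p) = q * r"
      using det det' s by Groebner_Basis.algebra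
    then have "r' + u * p = r" using \<open>q \<noteq> 0\<close> by simp
    moreover have "mat2 1 0 u 1 ** mat2 p q r' s' \<in> H" by (intro mult_mem lo M)
    ultimately show ?thesis using s by (simp add: add.commute)
  qed
  have "A \<in> H" if A: "A \<in> carrier SL2" for A
  proof -
    obtain p q r s where Aeq: "A = mat2 p q r s" by (rule mat2_cases)
    with A have det: "p * s - q * r = 1" by simp
    show ?thesis
    proof (cases "q = 0")
      case False
      with gen det Aeq show ?thesis by simp
    next
      case True
      with det have "p \<noteq> 0" by auto
      have dY: "a * d - b * c = 1" by (rule det_eq_1[OF Y(1)])
      have "mat2 p q r s ** mat2 a b c d \<in> H"
      proof (subst mat2_mult, rule gen)
        show "p * b + q * d \<noteq> 0" using True \<open>p \<noteq> 0\<close> Y by simp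
        show "(p * a + q * c) * (r * b + s * d) - (p * b + q * d) * (r * a + s * c) = 1"
          using det dY by Groebner_Basis.algebra
      qed
      then have "mat2 p q r s ** mat2 a b c d ** mat2 d (- b) (- c) a \<in> H"
        by (rule mult_mem[OF _ inv_mem[OF Y(1)]])
      then have "mat2 p q r s ** (mat2 a b c d ** mat2 d (- b) (- c) a) \<in> H"
        by (simp only: matrix_mul_assoc)
      moreover have "mat2 a b c d ** mat2 d (- b) (- c) a = mat 1"
        using dY by (simp add: mat_1_eq_mat2 algebra_simps)
      ultimately show ?thesis
        by (simp only: Aeq matrix_mul_rid)
    qed
  qed
  then show ?thesis using subgroup.subset[OF sub] by blast
qed

text \<open>With a zero upper left entry, conjugating \<open>diag(l, 1/l)\<close> by
  \<open>h\<close> gives a lower triangular matrix with diagonal \<open>1/l, l\<close>. Multiplying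
  by \<open>diag(l, 1/l)\<close> leaves a lower unipotent, nontrivial because \<open>d\<close> and
  \<open>l ^ 2 - 1\<close> are nonzero.\<close>

lemma eq_SL2_if_zero_entry:
  assumes h: "mat2 0 b c d \<in> H" "d \<noteq> 0" and l: "(l :: 'a) \<noteq> 0" "l ^ 2 \<noteq> 1"
  shows "H = carrier SL2"
proof -
  have det: "- (b * c) = 1" using det_eq_1[OF h(1)] by simp
  then have nz: "b \<noteq> 0" "c \<noteq> 0" by auto
  have "mat2 l 0 0 (1 / l) ** (mat2 0 b c d ** (mat2 l 0 0 (1 / l) ** mat2 d (- b) (- c) 0)) \<in> H"
    using l by (intro mult_mem inv_mem diag h)
  moreover have "mat2 l 0 0 (1 / l) ** (mat2 0 b c d ** (mat2 l 0 0 (1 / l) ** mat2 d (- b) (- c) 0))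
    = mat2 1 0 (c * d * (1 - 1 / l ^ 2)) 1"
    using l det by (auto simp: field_simps power2_eq_square)
  moreover have "c * d * (1 - 1 / l ^ 2) \<noteq> 0" using nz l h by auto
  ultimately show ?thesis
    using lower_unipotent_mem eq_SL2_if_lower_unipotent[OF _ h(1) nz(1)] by metis
qed

text \<open>The two square conditions are what is needed to make the upper left entry of a product
  vanish. Since the determinant is 1, \<open>(a * d) ^ 2 - (b * c) ^ 2 = a * d + b * c\<close>, so
  \<open>ne\<close> keeps the lower right entry from vanishing with it.\<close>

lemma eq_SL2_if_square:
  assumes Y: "mat2 a b c d \<in> H" and bc: "b * c \<noteq> 0" and ad: "a \<noteq> 0 \<or> d \<noteq> 0"
    and sq: "- (b * c) = k ^ 2 \<or> (a * d * b * c = k ^ 2 \<and> k \<noteq> 0)"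
    and ne: "a * d + b * c \<noteq> 0" and l: "(l :: 'a) \<noteq> 0" "l ^ 2 \<noteq> 1"
  shows "H = carrier SL2"
proof -
  have det: "a * d - b * c = 1" by (rule det_eq_1[OF Y])
  then have prod: "(a * d) ^ 2 \<noteq> (b * c) ^ 2"
    using ne by Groebner_Basis.algebra
  show ?thesis
  proof (cases "a = 0")
    case True
    then show ?thesis using eq_SL2_if_zero_entry Y ad l by auto
  next
    case a: False
    from sq show ?thesis
    proof
      assume k: "- (b * c) = k ^ 2"
      \<comment> \<open>This \<open>r\<close> makes the upper left entry of \<open>Y diag(r, 1/r) Y\<close> vanish.\<close>
      define r where "r = k / a"
      have r: "r \<noteq> 0" "a * r = k" using a k bc by (auto simp: r_def)
      have e: "mat2 a b c d ** (mat2 r 0 0 (1 / r) ** mat2 a b c d) \<in> H"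
        using r by (intro mult_mem diag Y)
      have "a ^ 2 * r ^ 2 + b * c = 0" using k r by Groebner_Basis.algebra
      then have 1: "a * (r * a) + b * (1 / r * c) = 0"
        using r by (simp add: field_simps power2_eq_square)
      have "b * c * r ^ 2 + d ^ 2 \<noteq> 0"
      proof
        assume "b * c * r ^ 2 + d ^ 2 = 0"
        with r k have "(a * d) ^ 2 = (b * c) ^ 2" by Groebner_Basis.algebra
        with prod show False by simp
      qed
      then have 2: "c * (r * b) + d * (1 / r * d) \<noteq> 0"
        using r by (auto simp: field_simps power2_eq_square)
      show ?thesis
        using e 1 2 eq_SL2_if_zero_entry[OF _ 2 l] by simp
    next
      assume k: "a * d * b * c = k ^ 2 \<and> k \<noteq> 0"
      then have nz: "a * d \<noteq> 0" by auto
      \<comment> \<open>Here it is the upper left entry of \<open>Y diag(r, 1/r) Y\<^sup>-\<^sup>1\<close> that vanishes.\<close>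
      define r where "r = k / (a * d)"
      have r: "r \<noteq> 0" "a * d * r = k" using nz k by (auto simp: r_def)
      have e: "mat2 a b c d ** (mat2 r 0 0 (1 / r) ** mat2 d (- b) (- c) a) \<in> H"
        using r by (intro mult_mem inv_mem diag Y)
      have "a * d * (a * d * r ^ 2) = a * d * (b * c)" using k r by Groebner_Basis.algebra
      then have rr: "a * d * r ^ 2 = b * c" using nz by simp
      then have 1: "a * (r * d) + b * (1 / r * - c) = 0"
        using r(1) by (simp add: field_simps power2_eq_square)
      have "a * d - b * c * r ^ 2 \<noteq> 0"
      proof
        assume "a * d - b * c * r ^ 2 = 0"
        with rr have "(a * d) ^ 2 = (b * c) ^ 2" by Groebner_Basis.algebra
        with prod show False by simp
      qed
      then have 2: "c * (r * - b) + d * (1 / r * a) \<noteq> 0"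
        using r by (auto simp: field_simps power2_eq_square)
      show ?thesis
        using e 1 2 eq_SL2_if_zero_entry[OF _ 2 l] by simp
    qed
  qed
qed

text \<open>If \<open>a * d + b * c = 0\<close>, the two diagonal entries of the products used
  before vanish together, so \<open>Y\<close> itself does not serve.\<close>

lemma eq_SL2:
  assumes Y: "mat2 a b c d \<in> H" and bc: "b * c \<noteq> 0" and ad: "a \<noteq> 0 \<or> d \<noteq> 0"
    and sq: "- (b * c) = k ^ 2 \<or> (a * d * b * c = k ^ 2 \<and> k \<noteq> 0)"
    and ne: "a * d + b * c \<noteq> 0 \<or> l ^ 8 \<noteq> 1" and l: "(l :: 'a) \<noteq> 0" "l ^ 2 \<noteq> 1"
  shows "H = carrier SL2"
proof (cases "a * d + b * c = 0")
  case False
  then show ?thesis using eq_SL2_if_square Y bc ad sq l by blast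
next
  case True
  have det: "a * d - b * c = 1" by (rule det_eq_1[OF Y])
  have nz: "a \<noteq> 0" "b \<noteq> 0" "c \<noteq> 0" "d \<noteq> 0" using True bc by auto
  \<comment> \<open>Replace \<open>Y\<close> by \<open>Y diag(r, 1/r) Y\<close>, for which the square condition holds automatically.\<close>
  have "l ^ 8 \<noteq> 1" using True ne by auto
  \<comment> \<open>If both \<open>r = 1\<close> and \<open>r = l\<close> failed, comparing them
    would give \<open>l ^ 8 = 1\<close>.\<close>
  have "\<exists>r. r \<noteq> 0 \<and> a ^ 4 * r ^ 8 \<noteq> d ^ 4"
  proof (rule ccontr)
    assume "\<not> ?thesis"
    then have "a ^ 4 * 1 ^ 8 = d ^ 4" "a ^ 4 * l ^ 8 = d ^ 4"
      using l by (metis one_neq_zero, blast)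
    then have "a ^ 4 * (l ^ 8 - 1) = 0" by (simp add: algebra_simps)
    with nz \<open>l ^ 8 \<noteq> 1\<close> show False by simp
  qed
  then obtain r where r: "r \<noteq> 0" "a ^ 4 * r ^ 8 \<noteq> d ^ 4" by blast
  define s where "s = 1 / r"
  have rs: "r * s = 1" using r by (simp add: s_def)
  define u where "u = a * r + d * s"
  define v where "v = a * r - d * s"
  \<comment> \<open>The product is \<open>a^4 r^4 - d^4 s^4\<close>, which is
    \<open>a^4 r^8 - d^4\<close> up to the factor \<open>r^4\<close>. Its first two factors keep the
    entries of the new matrix nonzero; the third one gives the new condition
    \<open>ne\<close>.\<close>
  have "u * v * (a ^ 2 * r ^ 2 + d ^ 2 * s ^ 2) \<noteq> 0"
  proof
    assume "u * v * (a ^ 2 * r ^ 2 + d ^ 2 * s ^ 2) = 0"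
    then have "a ^ 4 * r ^ 8 = d ^ 4"
      using rs unfolding u_def v_def by Groebner_Basis.algebra
    with r show False by simp
  qed
  then have uv: "u \<noteq> 0" "v \<noteq> 0" "a ^ 2 * r ^ 2 + d ^ 2 * s ^ 2 \<noteq> 0" by auto
  have "mat2 a b c d ** (mat2 r 0 0 s ** mat2 a b c d) \<in> H"
    unfolding s_def using r by (intro mult_mem diag Y)
  moreover have "mat2 a b c d ** (mat2 r 0 0 s ** mat2 a b c d) =
      mat2 (a * v) (b * u) (c * u) (- (d * v))"
  proof -
    have "a * (r * a) + b * (s * c) = a * v" "a * (r * b) + b * (s * d) = b * u"
      "c * (r * a) + d * (s * c) = c * u" "c * (r * b) + d * (s * d) = - (d * v)"
      unfolding u_def v_def using True by Groebner_Basis.algebra+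
    then show ?thesis by simp
  qed
  ultimately have Y': "mat2 (a * v) (b * u) (c * u) (- (d * v)) \<in> H" by simp
  show ?thesis
  proof (rule eq_SL2_if_square[OF Y' _ _ _ _ l])
    show "b * u * (c * u) \<noteq> 0" "a * v \<noteq> 0 \<or> - (d * v) \<noteq> 0" using nz uv by auto
    have "a * v * - (d * v) * (b * u) * (c * u) = (b * c * u * v) ^ 2"
      using True by Groebner_Basis.algebra
    then show "- (b * u * (c * u)) = (b * c * u * v) ^ 2 \<or>
        a * v * - (d * v) * (b * u) * (c * u) = (b * c * u * v) ^ 2 \<and> b * c * u * v \<noteq> 0"
      using nz uv by auto
    have "a * v * - (d * v) + b * u * (c * u) = - (a ^ 2 * r ^ 2 + d ^ 2 * s ^ 2)"
      using True det unfolding u_def v_def by Groebner_Basis.algebra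
    then show "a * v * - (d * v) + b * u * (c * u) \<noteq> 0"
      using uv(3) by (simp only: neg_equal_0_iff_equal not_False_eq_True)
  qed
qed

end

section \<open>Beauville structures on quotients\<close>

text \<open>Expresses the set in the quotient by conjugates of powers upstairs, so that all later
  work takes place with matrices rather than cosets.\<close>

lemma (in group_hom) beauville_Sigma_image:
  assumes surj: "h ` carrier G = carrier H" and xy: "x \<in> carrier G" "y \<in> carrier G"
  shows "beauville_Sigma H (h x) (h y) =
    {h (g \<otimes> X [^] j \<otimes> inv g) | g X j. g \<in> carrier G \<and> X \<in> {x, y, inv (x \<otimes> y)} \<and> 1 \<le> (j::nat)}"
proof -
  have hom: "h (g \<otimes> X [^] j \<otimes> inv g) = h g \<otimes>\<^bsub>H\<^esub> (h X [^]\<^bsub>H\<^esub> j) \<otimes>\<^bsub>H\<^esub> inv\<^bsub>H\<^esub> (h g)"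
    if "g \<in> carrier G" "X \<in> carrier G" for g X and j :: nat
    using that by (simp add: hom_nat_pow)
  have inv: "inv\<^bsub>H\<^esub> (h x \<otimes>\<^bsub>H\<^esub> h y) = h (inv (x \<otimes> y))"
    using xy by (simp del: G.inv_mult_group)
  have "beauville_Sigma H (h x) (h y) = (\<Union>g \<in> carrier G. \<Union>j \<in> {1::nat..}.
    {h (g \<otimes> x [^] j \<otimes> inv g), h (g \<otimes> y [^] j \<otimes> inv g),
     h (g \<otimes> inv (x \<otimes> y) [^] j \<otimes> inv g)})"
    unfolding beauville_Sigma_def Let_def inv surj[symmetric]
    using xy by (simp add: hom del: hom_mult hom_inv H.inv_mult_group G.inv_mult_group)
  then show ?thesis by (simp only:) blast
qed

lemma (in group_hom) unmixed_beauville_structure_image: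
  assumes surj: "h ` carrier G = carrier H" and fin: "finite (carrier H)"
    and c: "{x1, y1, x2, y2} \<subseteq> carrier G"
    and gen: "generate G {x1, y1} = carrier G" "generate G {x2, y2} = carrier G"
    and disj: "\<And>X W g i j. X \<in> {x1, y1, inv (x1 \<otimes> y1)} \<Longrightarrow> W \<in> {x2, y2, inv (x2 \<otimes> y2)} \<Longrightarrow>
      g \<in> carrier G \<Longrightarrow> h (X [^] (i::nat)) = h (g \<otimes> W [^] (j::nat) \<otimes> inv g) \<Longrightarrow> h (X [^] i) = \<one>\<^bsub>H\<^esub>"
  shows "unmixed_beauville_structure H (h x1) (h y1) (h x2) (h y2)"
proof -
  have c12: "x1 \<in> carrier G" "y1 \<in> carrier G" "x2 \<in> carrier G" "y2 \<in> carrier G"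
    using c by auto
  have gens: "generate H {h x, h y} = carrier H"
    if "generate G {x, y} = carrier G" "x \<in> carrier G" "y \<in> carrier G" for x y
    using generate_img[of "{x, y}"] that surj by simp
  have one: "\<one>\<^bsub>H\<^esub> \<in> beauville_Sigma H (h x) (h y)" if "x \<in> carrier G" "y \<in> carrier G" for x y
  proof -
    \<comment> \<open>Exponents start at 1, so the identity is reached through the group order and
      not through the exponent 0.\<close>
    have "h (\<one> \<otimes> x [^] order H \<otimes> inv \<one>) = \<one>\<^bsub>H\<^esub>"
      using that by (simp add: hom_nat_pow H.pow_order_eq_1)
    moreover have "1 \<le> order H"
      using fin H.order_gt_0_iff_finite by fastforce
    ultimately show ?thesis
      unfolding beauville_Sigma_image[OF surj that] using G.one_closed
      by (intro CollectI exI[of _ \<one>] exI[of _ x] exI[of _ "order H"]) simp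
  qed
  have "s = \<one>\<^bsub>H\<^esub>"
    if s: "s \<in> beauville_Sigma H (h x1) (h y1)" "s \<in> beauville_Sigma H (h x2) (h y2)" for s
  proof -
    obtain k X i where X: "k \<in> carrier G" "X \<in> {x1, y1, inv (x1 \<otimes> y1)}"
      and s1: "s = h (k \<otimes> X [^] (i::nat) \<otimes> inv k)"
      using s(1) unfolding beauville_Sigma_image[OF surj c12(1,2)] by blast
    obtain l W j where W: "l \<in> carrier G" "W \<in> {x2, y2, inv (x2 \<otimes> y2)}"
      and s2: "s = h (l \<otimes> W [^] (j::nat) \<otimes> inv l)"
      using s(2) unfolding beauville_Sigma_image[OF surj c12(3,4)] by blast
    have Xc: "X \<in> carrier G" and Wc: "W \<in> carrier G" using X W c12 by auto
    \<comment> \<open>Moving the conjugation by \<open>k\<close> to the other side leaves a plain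
      power of \<open>X\<close> against one conjugate of a power of \<open>W\<close>.\<close>
    define g where "g = inv k \<otimes> l"
    have g: "g \<in> carrier G" using X W by (simp add: g_def)
    have eq: "h (k \<otimes> X [^] i \<otimes> inv k) = h (l \<otimes> W [^] j \<otimes> inv l)" using s1 s2 by simp
    have "X [^] i = inv k \<otimes> (k \<otimes> X [^] i \<otimes> inv k) \<otimes> k"
      using X(1) Xc by (simp add: G.m_assoc G.inv_solve_left)
    then have "h (X [^] i) = h (inv k) \<otimes>\<^bsub>H\<^esub> h (k \<otimes> X [^] i \<otimes> inv k) \<otimes>\<^bsub>H\<^esub> h k"
      using X(1) Xc by (metis G.inv_closed G.m_closed G.nat_pow_closed hom_mult)
    also have "\<dots> = h (inv k \<otimes> (l \<otimes> W [^] j \<otimes> inv l) \<otimes> k)"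
      unfolding eq using X(1) W(1) Wc by (simp del: hom_inv)
    also have "inv k \<otimes> (l \<otimes> W [^] j \<otimes> inv l) \<otimes> k = g \<otimes> W [^] j \<otimes> inv g"
      using X(1) W(1) Wc by (simp add: g_def G.inv_mult_group G.m_assoc)
    finally have "h (X [^] i) = \<one>\<^bsub>H\<^esub>" by (rule disj[OF X(2) W(2) g])
    then show ?thesis using X(1) Xc by (simp add: s1)
  qed
  then show ?thesis
    unfolding unmixed_beauville_structure_def using c gens gen one by auto
qed

section \<open>Traces\<close>

text \<open>For determinant 1 the eigenvalues are \<open>m\<close> and \<open>1 / m\<close>. This
  predicate says that they lie in the field; \<open>split_trace\<close> says that they are moreover
  distinct.\<close>

definition eigenvalue_trace :: "'a::field \<Rightarrow> bool" where
  "eigenvalue_trace t \<longleftrightarrow> (\<exists>m. m \<noteq> 0 \<and> t = m + 1 / m)"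

definition split_trace :: "'a::field \<Rightarrow> bool" where
  "split_trace t \<longleftrightarrow> (\<exists>m. m \<noteq> 0 \<and> m \<noteq> 1 / m \<and> t = m + 1 / m)"

lemma trace_mat2 [simp]: "trace (mat2 a b c d) = a + d"
  by (simp add: trace_def sum_2)

lemma trace_inv_SL2:
  assumes "A \<in> carrier SL2"
  shows "trace (inv\<^bsub>SL2\<^esub> A) = trace A"
  using assms by (cases rule: mat2_cases[of A]) (simp add: inv_SL2 add.commute)

lemma trace_conj_SL2:
  assumes "A \<in> carrier SL2" "g \<in> carrier SL2"
  shows "trace (g \<otimes>\<^bsub>SL2\<^esub> A \<otimes>\<^bsub>SL2\<^esub> inv\<^bsub>SL2\<^esub> g) = trace A"
proof -
  obtain a b c d where A: "A = mat2 a b c d" by (rule mat2_cases)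
  obtain p q r s where g: "g = mat2 p q r s" by (rule mat2_cases)
  have det: "p * s - q * r = 1" using assms g by simp
  then have "(p * a + q * c) * s - (p * b + q * d) * r + ((r * b + s * d) * p - (r * a + s * c) * q) = a + d"
    by Groebner_Basis.algebra
  then show ?thesis by (simp add: A g inv_SL2[OF det])
qed

section \<open>The centre of SL(2,q) and centralisers of nonscalar matrices\<close>

lemma scalar_in_center:
  "k ^ 2 = 1 \<Longrightarrow> mat2 k 0 0 k \<in> group_center SL2"
proof -
  assume k: "k ^ 2 = 1"
  have "g ** mat2 k 0 0 k = mat2 k 0 0 k ** g" for g
    by (cases rule: mat2_cases[of g]) (simp add: mult.commute)
  then show ?thesis using k by (simp add: group_center_def power2_eq_square)
qed

lemma center_SL2_scalar:
  assumes "z \<in> group_center SL2"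
  obtains k where "z = mat2 k 0 0 k"
proof -
  obtain a b c d where z: "z = mat2 a b c d" by (rule mat2_cases)
  have "mat2 1 1 0 1 ** z = z ** mat2 1 1 0 1" "mat2 1 0 1 1 ** z = z ** mat2 1 0 1 1"
    using assms unfolding group_center_def mult_SL2 by auto
  then have "z = mat2 a 0 0 a" by (auto simp: z)
  then show ?thesis by (rule that)
qed

text \<open>The centraliser of a nonscalar 2 by 2 matrix \<open>A\<close> consists of the
  polynomials \<open>u + v A\<close>. The coefficient \<open>v\<close> is read off from whichever of
  \<open>b\<close>, \<open>c\<close>, \<open>a - d\<close> is nonzero.\<close>

lemma commute_mat2_nonscalar:
  assumes comm: "mat2 a b c d ** mat2 p q r s = mat2 p q r s ** mat2 a b c d"
    and ns: "b \<noteq> 0 \<or> c \<noteq> 0 \<or> a \<noteq> d"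
  obtains u v where "p = u + v * a" "q = v * b" "r = v * c" "s = u + v * d"
proof -
  have 2: "a * p + b * r = p * a + q * c" "a * q + b * s = p * b + q * d"
    "c * p + d * r = r * a + s * c" using comm by auto
  have eqs: "b * r = q * c" "q * (a - d) = b * (p - s)" "r * (a - d) = c * (p - s)"
    using 2 by Groebner_Basis.algebra+
  consider "b \<noteq> 0" | "c \<noteq> 0" | "a \<noteq> d" using ns by blast
  then obtain v where v: "q = v * b" "r = v * c" "p - s = v * (a - d)"
  proof cases
    case 1
    show ?thesis by (rule that[of "q / b"]) (use 1 eqs in \<open>auto simp: nonzero_eq_divide_eq mult_ac\<close>)
  next
    case 2
    show ?thesis by (rule that[of "r / c"]) (use 2 eqs in \<open>auto simp: nonzero_eq_divide_eq mult_ac\<close>)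
  next
    case 3
    then show ?thesis
      by (intro that[of "(p - s) / (a - d)"])
        (use eqs in \<open>auto simp: nonzero_eq_divide_eq mult_ac\<close>)
  qed
  show ?thesis
    by (rule that[of "p - v * a" v]) (use v in \<open>auto simp: algebra_simps\<close>)
qed

text \<open>Two ways for the numbers of distinct eigenvalues in the field to differ: two against at
  most one, or none against at least one. Fields with more than seven elements use the first, the
  field with seven elements the second.\<close>

definition trace_separated :: "'a::field \<Rightarrow> 'a \<Rightarrow> bool" where
  "trace_separated t s \<longleftrightarrow>
    split_trace t \<and> \<not> split_trace s \<or> \<not> eigenvalue_trace t \<and> eigenvalue_trace s"

text \<open>If \<open>m\<close> is an eigenvalue of \<open>X\<close>, then \<open>u + v * m\<close>
  is one of \<open>u + v X\<close>, and this map is invertible as \<open>v\<close> is nonzero. The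
  condition \<open>norm\<close> is the determinant of \<open>u + v X\<close> written with
  \<open>t\<close>.\<close>

lemma not_trace_separated_affine:
  fixes a b c d u v :: "'a::field"
  assumes X: "a * d - b * c = 1" and W: "(u + v * a) * (u + v * d) - v * b * (v * c) = 1"
    and v: "v \<noteq> 0"
  shows "\<not> trace_separated (a + d) (2 * u + v * (a + d))"
proof -
  define t where "t = a + d"
  have norm: "u ^ 2 + u * v * t + v ^ 2 = 1"
    using X W unfolding t_def by Groebner_Basis.algebra
  have "split_trace (2 * u + v * t)" if "split_trace t"
  proof -
    from that obtain m where m: "m \<noteq> 0" "m \<noteq> 1 / m" "t = m + 1 / m"
      by (auto simp: split_trace_def)
    define m' where "m' = 1 / m"
    have mm': "m * m' = 1" "t = m + m'" using m by (auto simp: m'_def)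
    have e: "(u + v * m) * (u + v * m') = 1"
      using norm mm' by Groebner_Basis.algebra
    then have nz: "u + v * m \<noteq> 0" by auto
    then have e': "1 / (u + v * m) = u + v * m'"
      using e by (simp add: nonzero_divide_eq_eq mult.commute)
    show ?thesis unfolding split_trace_def
    proof (intro exI[of _ "u + v * m"] conjI nz)
      have "m \<noteq> m'" using m(2) by (simp add: m'_def)
      then have "v * m \<noteq> v * m'" using v by simp
      then show "u + v * m \<noteq> 1 / (u + v * m)" using e' by simp
      show "2 * u + v * t = u + v * m + 1 / (u + v * m)"
        unfolding e' mm'(2) by (simp add: algebra_simps)
    qed
  qed
  moreover have "eigenvalue_trace t" if "eigenvalue_trace (2 * u + v * t)"
  proof -
    from that obtain m where m: "m \<noteq> 0" "2 * u + v * t = m + 1 / m"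
      by (auto simp: eigenvalue_trace_def)
    define m' where "m' = 1 / m"
    have mm': "m * m' = 1" "2 * u + v * t = m + m'" using m by (auto simp: m'_def)
    define n where "n = (m - u) / v"
    define n' where "n' = (m' - u) / v"
    have n: "v * n = m - u" "v * n' = m' - u" using v by (auto simp: n_def n'_def)
    have "v ^ 2 * (n * n') = v ^ 2 * 1" using n mm' norm by Groebner_Basis.algebra
    then have e: "n * n' = 1" using v by simp
    then have nz: "n \<noteq> 0" by auto
    have "v * t = v * (n + n')" using n mm' by Groebner_Basis.algebra
    then have "t = n + n'" using v by simp
    moreover have "n' = 1 / n" using e nz by (simp add: nonzero_eq_divide_eq mult.commute)
    ultimately show ?thesis using nz by (auto simp: eigenvalue_trace_def)
  qed
  ultimately show ?thesis by (auto simp: trace_separated_def t_def)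
qed

lemma (in group) conj_nat_pow:
  assumes "x \<in> carrier G" "g \<in> carrier G"
  shows "(g \<otimes> x \<otimes> inv g) [^] (n::nat) = g \<otimes> x [^] n \<otimes> inv g"
proof (induction n)
  case (Suc n)
  have "inv g \<otimes> (g \<otimes> (x \<otimes> inv g)) = x \<otimes> inv g"
    using assms by (metis inv_closed l_inv l_one m_assoc m_closed)
  then show ?case using assms Suc by (simp add: m_assoc)
qed (use assms in simp)

lemma power_in_center_if_trace_separated:
  fixes X V :: "'a::field ^ 2 ^ 2"
  assumes X: "X \<in> carrier SL2" and V: "V \<in> carrier SL2"
    and sep: "trace_separated (trace X) (trace V)"
    and z: "z \<in> group_center SL2"
    and eq: "X [^]\<^bsub>SL2\<^esub> (i::nat) = z \<otimes>\<^bsub>SL2\<^esub> V [^]\<^bsub>SL2\<^esub> (j::nat)"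
  shows "X [^]\<^bsub>SL2\<^esub> i \<in> group_center SL2"
proof (rule ccontr)
  let ?A = "X [^]\<^bsub>SL2\<^esub> i"
  interpret S: group "SL2 :: ('a ^ 2 ^ 2) monoid" by (rule group_SL2)
  have cen: "subgroup (group_center SL2) (SL2 :: ('a ^ 2 ^ 2) monoid)"
    using S.group_center_normal by (rule normal_imp_subgroup)
  have pow: "B [^]\<^bsub>SL2\<^esub> n \<in> group_center SL2" if "B \<in> group_center SL2"
    for B :: "'a ^ 2 ^ 2" and n :: nat
    using that by (induction n) (auto intro: subgroup.one_closed[OF cen] subgroup.m_closed[OF cen]
        simp del: mult_SL2)
  assume nc: "?A \<notin> group_center SL2"
  have XA: "?A ** X = X ** ?A"
    using S.nat_pow_Suc2[OF X, of i] by simp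
  have zc: "z ** B = B ** z" if "B \<in> carrier SL2" for B
    using z that by (auto simp: group_center_def)
  have VV: "V [^]\<^bsub>SL2\<^esub> j ** V = V ** V [^]\<^bsub>SL2\<^esub> j"
    using S.nat_pow_Suc2[OF V, of j] by simp
  have "?A ** V = z ** (V ** V [^]\<^bsub>SL2\<^esub> j)"
    unfolding eq mult_SL2 VV[symmetric] by (rule matrix_mul_assoc[symmetric])
  also have "\<dots> = V ** ?A"
    unfolding eq mult_SL2 matrix_mul_assoc zc[OF V] ..
  finally have VA: "?A ** V = V ** ?A" .
  obtain a b c d where A: "?A = mat2 a b c d" by (rule mat2_cases)
  have "mat2 a b c d \<in> carrier SL2" using S.nat_pow_closed[OF X, of i] A by simp
  then have detA: "a * d - b * c = 1" by simp
  have ns: "b \<noteq> 0 \<or> c \<noteq> 0 \<or> a \<noteq> d"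
    using nc scalar_in_center[of a] detA unfolding A by (auto simp: power2_eq_square)
  obtain p q r s where Xm: "X = mat2 p q r s" by (rule mat2_cases)
  obtain p' q' r' s' where Vm: "V = mat2 p' q' r' s'" by (rule mat2_cases)
  obtain u v where uv: "p = u + v * a" "q = v * b" "r = v * c" "s = u + v * d"
    using commute_mat2_nonscalar[OF XA[unfolded A, unfolded Xm] ns] .
  obtain u' v' where uv': "p' = u' + v' * a" "q' = v' * b" "r' = v' * c" "s' = u' + v' * d"
    using commute_mat2_nonscalar[OF VA[unfolded A, unfolded Vm] ns] .
  have dX: "p * s - q * r = 1" and dV: "p' * s' - q' * r' = 1" using X V Xm Vm by auto
  \<comment> \<open>Otherwise \<open>X\<close>, and with it the power \<open>?A\<close>, would be
    central.\<close>
  have v: "v \<noteq> 0"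
  proof
    assume "v = 0"
    then have "X \<in> group_center SL2"
      using scalar_in_center[of u] dX by (simp add: Xm uv power2_eq_square)
    with pow nc show False by blast
  qed
  have v': "v' \<noteq> 0"
  proof
    assume "v' = 0"
    then have "V \<in> group_center SL2"
      using scalar_in_center[of u'] dV by (simp add: Vm uv' power2_eq_square)
    then have "?A \<in> group_center SL2"
      unfolding eq by (intro subgroup.m_closed[OF cen] z pow)
    with nc show False by blast
  qed
  \<comment> \<open>Eliminating \<open>?A\<close> from \<open>X = u + v ?A\<close> and
    \<open>V = u' + v' ?A\<close> gives \<open>V = x + y X\<close>.\<close>
  define y where "y = v' / v"
  define x where "x = u' - y * u"
  have y: "v * y = v'" "y \<noteq> 0" using v v' by (auto simp: y_def)
  have W: "p' = x + y * p" "q' = y * q" "r' = y * r" "s' = x + y * s"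
    unfolding uv uv' x_def y(1)[symmetric] by (simp_all add: algebra_simps)
  have "2 * x + y * (p + s) = trace V"
    by (simp add: Vm W algebra_simps)
  with not_trace_separated_affine[OF dX dV[unfolded W] y(2)] sep
  show False by (simp add: Xm)
qed

text \<open>The trace is invariant under conjugation and, in determinant 1, under inversion, so the
  third entry of a triple may be represented by the product of the first two. Equality of cosets
  supplies the central factor \<open>z\<close>.\<close>

lemma unmixed_beauville_structure_PSL2:
  fixes x1 y1 x2 y2 :: "'a::{field,finite} ^ 2 ^ 2"
  assumes c: "{x1, y1, x2, y2} \<subseteq> carrier SL2"
    and gen: "generate SL2 {x1, y1} = carrier SL2" "generate SL2 {x2, y2} = carrier SL2"
    and sep: "\<And>t s. t \<in> {trace x1, trace y1, trace (x1 ** y1)} \<Longrightarrow>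
      s \<in> {trace x2, trace y2, trace (x2 ** y2)} \<Longrightarrow> trace_separated t s"
  shows "\<exists>x1 y1 x2 y2. unmixed_beauville_structure (PSL2 :: ('a ^ 2 ^ 2) set monoid) x1 y1 x2 y2"
proof -
  let ?Z = "group_center (SL2 :: ('a ^ 2 ^ 2) monoid)"
  interpret S: group "SL2 :: ('a ^ 2 ^ 2) monoid" by (rule group_SL2)
  interpret N: normal ?Z "SL2 :: ('a ^ 2 ^ 2) monoid" by (rule S.group_center_normal)
  interpret P: group "PSL2 :: ('a ^ 2 ^ 2) set monoid" by (rule group_PSL2)
  interpret h: group_hom "SL2 :: ('a ^ 2 ^ 2) monoid" PSL2 "r_coset SL2 ?Z"
    by unfold_locales (use N.r_coset_hom_Mod in \<open>simp add: PSL2_def\<close>)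
  have surj: "r_coset SL2 ?Z ` carrier SL2 = carrier PSL2"
    by (auto simp: PSL2_def FactGroup_def RCOSETS_def)
  have c': "x1 \<in> carrier SL2" "y1 \<in> carrier SL2" "x2 \<in> carrier SL2" "y2 \<in> carrier SL2"
    using c by auto
  have tr: "trace X \<in> {trace x, trace y, trace (x ** y)}"
    if "X \<in> {x, y, inv\<^bsub>SL2\<^esub> (x \<otimes>\<^bsub>SL2\<^esub> y)}" "x \<in> carrier SL2" "y \<in> carrier SL2"
    for X x y :: "'a ^ 2 ^ 2"
    using that trace_inv_SL2[OF S.m_closed[OF that(2,3)]] by auto
  have "unmixed_beauville_structure PSL2 (?Z #>\<^bsub>SL2\<^esub> x1) (?Z #>\<^bsub>SL2\<^esub> y1) (?Z #>\<^bsub>SL2\<^esub> x2) (?Z #>\<^bsub>SL2\<^esub> y2)"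
  proof (rule h.unmixed_beauville_structure_image[OF surj finite_PSL2 c gen])
    fix X W g :: "'a ^ 2 ^ 2" and i j :: nat
    assume X: "X \<in> {x1, y1, inv\<^bsub>SL2\<^esub> (x1 \<otimes>\<^bsub>SL2\<^esub> y1)}"
      and W: "W \<in> {x2, y2, inv\<^bsub>SL2\<^esub> (x2 \<otimes>\<^bsub>SL2\<^esub> y2)}" and g: "g \<in> carrier SL2"
      and eq: "?Z #>\<^bsub>SL2\<^esub> (X [^]\<^bsub>SL2\<^esub> i) =
        ?Z #>\<^bsub>SL2\<^esub> (g \<otimes>\<^bsub>SL2\<^esub> W [^]\<^bsub>SL2\<^esub> j \<otimes>\<^bsub>SL2\<^esub> inv\<^bsub>SL2\<^esub> g)"
    have Xc: "X \<in> carrier SL2"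
      using X c' S.inv_closed[OF S.m_closed[OF c'(1,2)]] by blast
    have Wc: "W \<in> carrier SL2"
      using W c' S.inv_closed[OF S.m_closed[OF c'(3,4)]] by blast
    define V where "V = g \<otimes>\<^bsub>SL2\<^esub> W \<otimes>\<^bsub>SL2\<^esub> inv\<^bsub>SL2\<^esub> g"
    have V: "V \<in> carrier SL2"
      unfolding V_def by (intro S.m_closed S.inv_closed g Wc)
    have Vj: "g \<otimes>\<^bsub>SL2\<^esub> W [^]\<^bsub>SL2\<^esub> j \<otimes>\<^bsub>SL2\<^esub> inv\<^bsub>SL2\<^esub> g = V [^]\<^bsub>SL2\<^esub> j"
      unfolding V_def by (rule S.conj_nat_pow[OF Wc g, symmetric])
    have "X [^]\<^bsub>SL2\<^esub> i \<in> ?Z #>\<^bsub>SL2\<^esub> (V [^]\<^bsub>SL2\<^esub> j)"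
      using S.rcos_self[OF S.nat_pow_closed[OF Xc] N.subgroup_axioms, of i] eq Vj by simp
    then obtain z where z: "z \<in> ?Z" "X [^]\<^bsub>SL2\<^esub> i = z \<otimes>\<^bsub>SL2\<^esub> V [^]\<^bsub>SL2\<^esub> j"
      unfolding r_coset_def by blast
    have "trace_separated (trace X) (trace V)"
      unfolding V_def trace_conj_SL2[OF Wc g]
      by (intro sep tr X W c')
    from power_in_center_if_trace_separated[OF Xc V this z]
    have "?Z #>\<^bsub>SL2\<^esub> (X [^]\<^bsub>SL2\<^esub> i) = ?Z"
      by (intro S.coset_join2 S.nat_pow_closed Xc N.subgroup_axioms)
    then show "?Z #>\<^bsub>SL2\<^esub> (X [^]\<^bsub>SL2\<^esub> i) = \<one>\<^bsub>PSL2\<^esub>"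
      by (simp add: PSL2_def FactGroup_def)
  qed
  then show ?thesis by blast
qed

section \<open>Fields with more than seven elements\<close>

lemma torus_subgroupI:
  fixes l :: "'a::{field,finite}"
  assumes l: "primitive_root l" and H: "subgroup H SL2" "mat2 l 0 0 (1 / l) \<in> H"
  shows "torus_subgroup H"
proof (rule torus_subgroup.intro)
  show "subgroup H SL2" by fact
  have pow: "mat2 (l ^ k) 0 0 (1 / l ^ k) \<in> H" for k
  proof (induction k)
    case 0
    then show ?case using subgroup.one_closed[OF H(1)] by (simp add: one_SL2)
  next
    case (Suc k)
    show ?case using subgroup.m_closed[OF H(1) H(2) Suc] by simp
  qed
  show "mat2 r 0 0 (1 / r) \<in> H" if "r \<noteq> 0" for r
    using pow l that unfolding primitive_root_def by metis
qed

lemma generate_SL2I: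
  fixes l :: "'a::{field,finite}"
  assumes l: "primitive_root l" "l ^ 2 \<noteq> 1" and S: "S \<subseteq> carrier SL2"
    and dg: "mat2 l 0 0 (1 / l) \<in> generate SL2 S" and Y: "mat2 a b c d \<in> generate SL2 S"
    and bc: "b * c \<noteq> 0" and ad: "a \<noteq> 0 \<or> d \<noteq> 0"
    and sq: "- (b * c) = k ^ 2 \<or> (a * d * b * c = k ^ 2 \<and> k \<noteq> 0)"
    and ne: "a * d + b * c \<noteq> 0 \<or> l ^ 8 \<noteq> 1"
  shows "generate SL2 S = carrier SL2"
proof -
  interpret torus_subgroup "generate SL2 S"
    using l(1) group.generate_is_subgroup[OF group_SL2 S] dg by (rule torus_subgroupI)
  show ?thesis using eq_SL2[OF Y bc ad sq ne] l by (auto simp: primitive_root_def)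
qed

lemma power_card_minus_1:
  fixes x :: "'a::{field,finite}"
  assumes "x \<noteq> 0"
  shows "x ^ (CARD('a) - 1) = 1"
proof -
  obtain l :: 'a where l: "primitive_root l" using ex_primitive_root by blast
  with assms obtain k where "x = l ^ k" by (auto simp: primitive_root_def)
  then show ?thesis
    using primitive_root_power_card[OF l] by (metis mult.commute power_mult power_one)
qed

text \<open>Apart from \<open>l = 0\<close>, each excluded equation would give
  \<open>l ^ n = 1\<close> for some positive \<open>n\<close> up to 6, while the order of
  \<open>l\<close> is at least 7.\<close>

lemma primitive_root_low_powers:
  fixes l :: "'a::{field,finite}"
  assumes l: "primitive_root l" and card: "CARD('a) > 7"
  shows "l \<noteq> 0" "l \<noteq> 1" "l \<noteq> - 1" "l ^ 2 \<noteq> - 1" "l ^ 2 - l + 1 \<noteq> 0"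
proof -
  have pow: "l ^ n \<noteq> 1" if "0 < n" "n \<le> 6" for n
    using card_le_if_primitive_root_power_eq_1[OF l _ that(1)] that(2) card by auto
  show "l \<noteq> 0" using l by (simp add: primitive_root_def)
  show "l \<noteq> 1" using pow[of 1] by simp
  show "l \<noteq> - 1" using pow[of 2] by auto
  show "l ^ 2 \<noteq> - 1"
  proof
    assume "l ^ 2 = - 1"
    then have "l ^ 4 = 1" by Groebner_Basis.algebra
    with pow[of 4] show False by simp
  qed
  show "l ^ 2 - l + 1 \<noteq> 0"
  proof
    assume "l ^ 2 - l + 1 = 0"
    then have "l ^ 6 = 1" by Groebner_Basis.algebra
    with pow[of 6] show False by simp
  qed
qed

section \<open>The two generating pairs with prescribed traces\<close>

lemma generate_split_pair:
  fixes l :: "'a::{field,finite}"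
  assumes l: "primitive_root l" and card: "CARD('a) > 7"
  obtains a d where "generate SL2 {mat2 l 0 0 (1 / l), mat2 a 1 (a * d - 1) d} = carrier SL2"
    "a + d = l + 1 / l" "l * a + d / l = - (l + 1 / l)"
proof -
  note nz = primitive_root_low_powers[OF l card]
  define m where "m = 1 / l"
  have lm: "l * m = 1" using nz by (simp add: m_def)
  define T where "T = l + m"
  have "l * T = l ^ 2 + 1" using lm unfolding T_def by Groebner_Basis.algebra
  then have T: "T \<noteq> 0" using nz(4) by (auto simp: eq_neg_iff_add_eq_0)
  \<comment> \<open>Solves \<open>a + d = T\<close> and \<open>l a + d/l = - T\<close>.\<close>
  define n where "n = 1 / (l - 1)"
  have ln: "(l - 1) * n = 1" using nz by (simp add: n_def)
  define a where "a = - T * n"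
  define d where "d = T * l * n"
  have tr1: "a + d = T" using ln unfolding a_def d_def by Groebner_Basis.algebra
  have tr2: "l * a + d * m = - T"
    using ln lm unfolding a_def d_def by Groebner_Basis.algebra
  have ad: "a * d = - (l * (T * n) ^ 2)"
    unfolding a_def d_def by Groebner_Basis.algebra
  have adnz: "a * d \<noteq> 0"
    using T ln nz unfolding ad by auto
  \<comment> \<open>Clearing denominators in \<open>a * d = 1\<close> produces the sixth cyclotomic
    polynomial \<open>l ^ 2 - l + 1\<close>. Primitive roots of the field with seven elements are
    zeros of it, which is why that field is treated separately.\<close>
  have c: "a * d - 1 \<noteq> 0"
  proof
    assume "a * d - 1 = 0"
    then have "(l + 1) ^ 2 * (l ^ 2 - l + 1) = 0"
      using ad ln lm unfolding T_def by Groebner_Basis.algebra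
    with nz show False by (simp add: eq_neg_iff_add_eq_0)
  qed
  obtain k where k: "- (a * d - 1) = l ^ k"
    using l c unfolding primitive_root_def by (metis neg_equal_0_iff_equal)
  \<comment> \<open>By \<open>ad\<close>, the product \<open>a * d\<close> is \<open>-l\<close>
    times a square. So if \<open>-(a * d - 1)\<close> is itself \<open>l\<close> times a square,
    then \<open>a * d * (a * d - 1)\<close> is a square.\<close>
  have sq: "\<exists>w. - (1 * (a * d - 1)) = w ^ 2 \<or> (a * d * 1 * (a * d - 1) = w ^ 2 \<and> w \<noteq> 0)"
  proof (cases "even k")
    case True
    then obtain i where "k = 2 * i" by blast
    then have "- (1 * (a * d - 1)) = (l ^ i) ^ 2"
      using k by (simp add: power_mult mult.commute flip: power_mult)
    then show ?thesis by blast
  next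
    case False
    then obtain i where "k = 2 * i + 1" by (blast elim: oddE)
    then have "- (a * d - 1) = l * (l ^ i) ^ 2"
      using k by (simp add: mult.commute flip: power_mult)
    define g where "g = l ^ i"
    have "- (a * d - 1) = l * g ^ 2"
      unfolding g_def by fact
    then have "a * d * 1 * (a * d - 1) = (g * (l * (T * n))) ^ 2"
      using ad by Groebner_Basis.algebra
    moreover have "g * (l * (T * n)) \<noteq> 0" using nz T ln by (auto simp: g_def)
    ultimately show ?thesis by blast
  qed
  then obtain w where
    w: "- (1 * (a * d - 1)) = w ^ 2 \<or> (a * d * 1 * (a * d - 1) = w ^ 2 \<and> w \<noteq> 0)" by blast
  have ne: "a * d + 1 * (a * d - 1) \<noteq> 0 \<or> l ^ 8 \<noteq> 1"
  proof (rule ccontr)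
    assume "\<not> ?thesis"
    then have 0: "2 * (a * d) = 1" and "l ^ 8 = 1" by auto
    have "l ^ 4 \<noteq> 1"
      using card_le_if_primitive_root_power_eq_1[OF l, of 4] card by auto
    moreover have "(l ^ 4 - 1) * (l ^ 4 + 1) = 0" using \<open>l ^ 8 = 1\<close> by Groebner_Basis.algebra
    ultimately have "l ^ 4 + 1 = 0" by simp
    \<comment> \<open>From \<open>l ^ 4 = -1\<close> follows \<open>l ^ 2 + m ^ 2 = 0\<close>, and
      only \<open>2 * l * m\<close> survives in \<open>T ^ 2\<close>.\<close>
    then have "T ^ 2 = 2" using lm unfolding T_def by Groebner_Basis.algebra
    then have "2 * (a * d) = - (4 * l * n ^ 2)" unfolding ad by (simp add: power_mult_distrib)
    then have "(l - 1) ^ 2 * (- (4 * l * n ^ 2)) = (l - 1) ^ 2" using 0 by simp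
    moreover have "(l - 1) ^ 2 * (- (4 * l * n ^ 2)) = - (4 * l) * ((l - 1) * n) ^ 2"
      by (simp add: power_mult_distrib)
    ultimately have "- (4 * l) = (l - 1) ^ 2" using ln by simp
    then have "(l + 1) ^ 2 = 0" by Groebner_Basis.algebra
    with nz show False by (simp add: eq_neg_iff_add_eq_0)
  qed
  show ?thesis
  proof (rule that[of a d])
    show "generate SL2 {mat2 l 0 0 (1 / l), mat2 a 1 (a * d - 1) d} = carrier SL2"
    proof (rule generate_SL2I[OF l _ _ _ _ _ _ w ne])
      show "l\<^sup>2 \<noteq> 1" using nz by (simp add: power2_eq_1_iff)
    qed (use nz c adnz in \<open>auto intro: generate.incl\<close>)
  qed (use tr1 tr2 in \<open>simp_all add: T_def m_def\<close>)
qed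

text \<open>Prescribing \<open>tr Y = t\<close> and \<open>tr (x Y) = t'\<close> fixes the diagonal
  of \<open>Y\<close>. The condition on \<open>t * t'\<close> gives the third trace and also makes
  \<open>-(b c)\<close> a square; \<open>t\<close> and \<open>t'\<close> being distinct keeps
  \<open>b c\<close> nonzero. The hypothesis \<open>ne\<close> is \<open>a d + b c\<close> nonzero
  rewritten in \<open>t\<close> and \<open>t'\<close>.\<close>

lemma generate_nonsplit_pair:
  fixes l t t' :: "'a::{field,finite}"
  assumes l: "primitive_root l" and card: "CARD('a) > 7"
    and tt': "t * t' = l + 1 / l + 2" "t \<noteq> t'"
    and ne: "2 * ((l + 1 / l) * (t * t') - t ^ 2 - t' ^ 2) \<noteq> (l - 1 / l) ^ 2 \<or> l ^ 8 \<noteq> 1"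
  obtains x y where "generate SL2 {x, y} = carrier SL2" "{x, y} \<subseteq> carrier SL2"
    "trace x = t" "trace y = t'" "trace (x ** y) = 2"
proof -
  note nz = primitive_root_low_powers[OF l card]
  define m where "m = 1 / l"
  have lm: "l * m = 1" using nz by (simp add: m_def)
  have l2: "l ^ 2 \<noteq> 1" using nz by (simp add: power2_eq_1_iff)
  have "l \<noteq> m"
  proof
    assume "l = m"
    with lm have "l ^ 2 = 1" by (simp add: power2_eq_square)
    with l2 show False by simp
  qed
  \<comment> \<open>Solves \<open>a + d = t\<close> and \<open>l a + d/l = t'\<close>.\<close>
  define n where "n = 1 / (l - m)"
  have ln: "(l - m) * n = 1" using \<open>l \<noteq> m\<close> by (simp add: n_def)
  define a where "a = (t' - t * m) * n"
  define d where "d = (l * t - t') * n"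
  have tt'': "t * t' = l + m + 2" using tt' by (simp add: m_def)
  have tr: "a + d = t" "l * a + d * m = t'"
    using ln lm unfolding a_def d_def by Groebner_Basis.algebra+
  have sq: "- (1 * (a * d - 1)) = ((t - t') * n) ^ 2"
    using ln lm tt'' unfolding a_def d_def by Groebner_Basis.algebra
  have n: "n \<noteq> 0" using ln by auto
  have c: "a * d - 1 \<noteq> 0"
    using sq tt'(2) n by auto
  have "l * (t * t') = (l + 1) ^ 2" using lm tt'' by Groebner_Basis.algebra
  then have "t \<noteq> 0" using nz by (auto simp: eq_neg_iff_add_eq_0)
  then have ad: "a \<noteq> 0 \<or> d \<noteq> 0" using tr by auto
  have ne': "a * d + 1 * (a * d - 1) \<noteq> 0 \<or> l ^ 8 \<noteq> 1"
  proof -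
    have "2 * ((l + m) * (t * t') - t ^ 2 - t' ^ 2) = (l - m) ^ 2"
      if "a * d + 1 * (a * d - 1) = 0"
      using that ln lm unfolding a_def d_def by Groebner_Basis.algebra
    then show ?thesis using ne by (auto simp: m_def)
  qed
  let ?x = "mat2 l 0 0 (1 / l)" and ?Y = "mat2 a 1 (a * d - 1) d"
  interpret S: group "SL2 :: ('a ^ 2 ^ 2) monoid" by (rule group_SL2)
  have x: "?x \<in> carrier SL2" and Y: "?Y \<in> carrier SL2" using nz by auto
  have xY: "?x ** ?Y \<in> carrier SL2" using S.m_closed[OF x Y] by (simp del: mat2_mult)
  show ?thesis
  proof (rule that[of ?Y "?x ** ?Y"])
    show "generate SL2 {?Y, ?x ** ?Y} = carrier SL2"
    proof (rule generate_SL2I[OF l l2 _ _ _ _ ad disjI1[OF sq] ne'])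
      \<comment> \<open>The torus element is recovered as \<open>(x Y) Y^-1\<close>.\<close>
      have "(?x \<otimes>\<^bsub>SL2\<^esub> ?Y) \<otimes>\<^bsub>SL2\<^esub> inv\<^bsub>SL2\<^esub> ?Y \<in> generate SL2 {?Y, ?x ** ?Y}"
        by (rule generate.eng[OF generate.incl generate.inv]) (simp_all del: mat2_mult)
      then show "?x \<in> generate SL2 {?Y, ?x ** ?Y}"
        by (simp only: S.m_assoc[OF x Y S.inv_closed[OF Y]] S.r_inv[OF Y] S.r_one[OF x])
    qed (use c Y xY in \<open>auto intro: generate.incl simp del: mat2_mult\<close>)
    show "trace (?x ** ?Y) = t'" using tr by (simp add: m_def)
    show "trace (?Y ** (?x ** ?Y)) = 2"
    proof -
      have "a * (l * a) + m * (a * d - 1) + ((a * d - 1) * l + d * (m * d)) = 2"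
      proof -
        \<comment> \<open>This is \<open>tr(Y x Y) = tr(Y) tr(x Y) - tr(x)\<close>.\<close>
        have "a * (l * a) + m * (a * d - 1) + ((a * d - 1) * l + d * (m * d)) =
            (a + d) * (l * a + d * m) - (l + m)" by (simp add: algebra_simps)
        then show ?thesis using tt'' by (simp add: tr)
      qed
      then show ?thesis by (simp add: m_def)
    qed
  qed (use Y xY tr in simp_all)
qed

section \<open>Choosing traces outside the split set\<close>

lemma card_split_traces: "2 * card {t :: 'a::{field,finite}. split_trace t} \<le> CARD('a) - 2"
proof -
  let ?S = "{t :: 'a. split_trace t}"
  have "\<forall>t. \<exists>m. split_trace t \<longrightarrow> m \<noteq> 0 \<and> m \<noteq> 1 / m \<and> t = m + 1 / (m :: 'a)"
    unfolding split_trace_def by blast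
  then obtain g where g: "\<And>t :: 'a. split_trace t \<Longrightarrow> g t \<noteq> 0 \<and> g t \<noteq> 1 / g t \<and> t = g t + 1 / g t"
    by metis
  \<comment> \<open>\<open>g t\<close> and \<open>g' t\<close> are the two eigenvalues belonging to
    \<open>t\<close>. Both maps are injective with disjoint images avoiding 0 and 1, so each split
    trace uses up two field elements.\<close>
  define g' where "g' = (\<lambda>t. 1 / g t)"
  have g': "t = g' t + 1 / g' t" "g' t \<noteq> 0" "g' t \<noteq> 1" "g t \<noteq> 1" if "split_trace t" for t
    using g[OF that] unfolding g'_def by (auto simp: add.commute)
  have "inj_on g ?S" by (rule inj_onI) (use g in \<open>metis mem_Collect_eq\<close>)
  moreover have "inj_on g' ?S" by (rule inj_onI) (use g' in \<open>metis mem_Collect_eq\<close>)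
  moreover have "g ` ?S \<inter> g' ` ?S = {}"
  proof (rule ccontr)
    assume "g ` ?S \<inter> g' ` ?S \<noteq> {}"
    then obtain t s where ts: "split_trace t" "split_trace s" "g t = g' s" by auto
    then have "t = s" using g g' by metis
    with ts g show False by (auto simp: g'_def)
  qed
  ultimately have "card (g ` ?S \<union> g' ` ?S) = 2 * card ?S"
    by (simp add: card_Un_disjoint card_image)
  moreover have "card (g ` ?S \<union> g' ` ?S) \<le> card (UNIV - {0, 1 :: 'a})"
    using g g' by (intro card_mono) auto
  ultimately show ?thesis by (simp add: card_Diff_subset)
qed

text \<open>Requiring \<open>t\<close> and \<open>c / t\<close> to be nonsplit excludes at most
  \<open>q - 2\<close> values, and there are \<open>q - 1\<close> nonzero ones.\<close>

lemma ex_nonsplit_factorization: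
  fixes c :: "'a::{field,finite}"
  assumes c: "c \<noteq> 0"
  obtains t t' where "t * t' = c" "\<not> split_trace t" "\<not> split_trace t'"
proof -
  let ?S = "{t :: 'a. split_trace t}"
  have "card (?S \<union> (\<lambda>t. c / t) ` ?S) \<le> card ?S + card ?S"
    by (rule order.trans[OF card_Un_le]) (simp add: card_image_le)
  \<comment> \<open>The bound \<open>q >= 2\<close> matters because subtraction of naturals is
    truncated.\<close>
  moreover have "card {0, 1 :: 'a} \<le> CARD('a)" by (rule card_mono) auto
  ultimately have "card (?S \<union> (\<lambda>t. c / t) ` ?S) < card (UNIV - {0 :: 'a})"
    using card_split_traces[where 'a = 'a] by (simp add: card_Diff_singleton)
  then have "\<not> UNIV - {0} \<subseteq> ?S \<union> (\<lambda>t. c / t) ` ?S"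
    using card_mono[OF finite, of "UNIV - {0}" "?S \<union> (\<lambda>t. c / t) ` ?S"] by linarith
  then obtain t where t: "t \<noteq> 0" "\<not> split_trace t" "t \<notin> (\<lambda>t. c / t) ` ?S"
    by blast
  have "t = c / (c / t)" using c t by simp
  with t(3) have "\<not> split_trace (c / t)" by blast
  with t show ?thesis by (intro that[of t "c / t"]) auto
qed

lemma not_split_trace_2: "\<not> split_trace (2 :: 'a::field)"
proof
  assume "split_trace (2 :: 'a)"
  then obtain m :: 'a where m: "m \<noteq> 0" "m \<noteq> 1 / m" "2 = m + 1 / m"
    by (auto simp: split_trace_def)
  then have "2 * m = m * m + 1" by (metis distrib_right nonzero_divide_eq_eq)
  then have "(m - 1) ^ 2 = 0" by Groebner_Basis.algebra
  with m show False by simp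
qed

text \<open>Such a \<open>t\<close> equals \<open>m + 1 / m\<close> for a square root
  \<open>m\<close> of \<open>l\<close>, found from \<open>m t = m^2 + 1 = l + 1\<close>. Hence two
  nonsplit factors of \<open>l + 1 / l + 2\<close> cannot coincide.\<close>

lemma split_trace_if_square:
  fixes l t :: "'a::field"
  assumes l: "l \<noteq> 0" "l \<noteq> 1" "l \<noteq> - 1" and t: "t * t = l + 1 / l + 2"
  shows "split_trace t"
proof -
  have lt: "l * (t * t) = (l + 1) ^ 2"
    unfolding t using l by (simp add: field_simps power2_eq_square)
  then have "t \<noteq> 0" using l by (auto simp: eq_neg_iff_add_eq_0)
  define m where "m = (l + 1) / t"
  have mt: "m * t = l + 1" using \<open>t \<noteq> 0\<close> by (simp add: m_def)
  have "t * t * (m * m) = t * t * l" using lt mt by Groebner_Basis.algebra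
  then have mm: "m * m = l" using \<open>t \<noteq> 0\<close> by simp
  have m: "m \<noteq> 0" using mm l by auto
  have "m * t = m * m + 1" using mt mm by simp
  then have "t = m + 1 / m" using m by (simp add: field_simps)
  moreover have "m \<noteq> 1 / m" using m mm l by (metis nonzero_eq_divide_eq)
  ultimately show ?thesis using m by (auto simp: split_trace_def)
qed

text \<open>The hypotheses leave 8 or 9 elements; with 8, both \<open>l ^ 7\<close> and
  \<open>l ^ 8\<close> would be 1. So the field has 9 elements.\<close>

lemma power_8_eq_1_imp_char_3:
  fixes l :: "'a::{field,finite}"
  assumes l: "primitive_root l" and card: "CARD('a) > 7" and l8: "l ^ 8 = 1"
  shows "(3 :: 'a) = 0" "l ^ 4 = - 1" "\<And>x :: 'a. x \<noteq> 0 \<Longrightarrow> x ^ 8 = 1"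
proof -
  have "CARD('a) - 1 \<le> 8" by (rule card_le_if_primitive_root_power_eq_1[OF l l8]) simp
  moreover have "CARD('a) \<noteq> 8"
  proof
    assume "CARD('a) = 8"
    then have "l ^ 7 = 1" using primitive_root_power_card[OF l] by simp
    then have "l = 1" using l8 by Groebner_Basis.algebra
    with primitive_root_low_powers[OF l card] show False by simp
  qed
  ultimately have card9: "CARD('a) = 9" using card by simp
  show "x ^ 8 = 1" if "x \<noteq> 0" for x :: 'a
    using power_card_minus_1[OF that] card9 by simp
  have "of_nat CARD('a) = (0 :: 'a)"
    unfolding of_nat_eq_0_iff_char_dvd by (rule CHAR_dvd_CARD)
  then have "(3 :: 'a) * 3 = 0" by (simp add: card9)
  then show "(3 :: 'a) = 0" by (simp only: mult_eq_0_iff disj_absorb)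
  have "(l ^ 4 - 1) * (l ^ 4 + 1) = 0" using l8 by Groebner_Basis.algebra
  moreover have "l ^ 4 \<noteq> 1"
    using card_le_if_primitive_root_power_eq_1[OF l, of 4] card by auto
  ultimately show "l ^ 4 = - 1" by (simp add: eq_neg_iff_add_eq_0)
qed

lemma ex_nonsplit_traces:
  fixes l :: "'a::{field,finite}"
  assumes l: "primitive_root l" and card: "CARD('a) > 7"
  obtains t t' where "t * t' = l + 1 / l + 2" "t \<noteq> t'" "\<not> split_trace t" "\<not> split_trace t'"
    "2 * ((l + 1 / l) * (t * t') - t ^ 2 - t' ^ 2) \<noteq> (l - 1 / l) ^ 2 \<or> l ^ 8 \<noteq> 1"
proof (cases "l ^ 8 = 1")
  case False
  note nz = primitive_root_low_powers[OF l card]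
  have "l * (l + 1 / l + 2) = (l + 1) ^ 2"
    using nz by (simp add: field_simps power2_eq_square)
  then have "l + 1 / l + 2 \<noteq> 0" using nz by (auto simp: eq_neg_iff_add_eq_0)
  then obtain t t' where t: "t * t' = l + 1 / l + 2" "\<not> split_trace t" "\<not> split_trace t'"
    by (rule ex_nonsplit_factorization)
  moreover have "t \<noteq> t'" using split_trace_if_square[OF nz(1-3), of t] t by auto
  ultimately show ?thesis using that False by blast
next
  case True
  note q9 = power_8_eq_1_imp_char_3[OF l card True]
  define m where "m = 1 / l"
  define T where "T = l + m"
  have lm: "l * m = 1" using l by (simp add: m_def primitive_root_def)
  have TT: "T ^ 2 = 2" using q9(2) lm unfolding T_def by Groebner_Basis.algebra
  have two: "(2 :: 'a) = - 1" using q9(1) by (simp add: eq_neg_iff_add_eq_0)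
  have "(1 :: 'a) \<noteq> - 1"
  proof
    assume "(1 :: 'a) = - 1"
    then have "(2 :: 'a) = 0" by (simp add: eq_neg_iff_add_eq_0)
    with two show False by simp
  qed
  then have T: "T \<noteq> 1" "T \<noteq> - 1" using TT[unfolded two] by auto
  show ?thesis
  \<comment> \<open>Explicit traces for nine elements: there \<open>-2 = 1\<close>, so
    \<open>2 * (1 - T) = T + 2\<close>, and \<open>T ^ 2 = -1\<close> keeps \<open>T\<close> away
    from 1 and -1.\<close>
  proof (rule that[of 2 "1 - T"], fold m_def, fold T_def)
    show "2 * (1 - T) = T + 2" unfolding two by simp
    show "2 \<noteq> 1 - T"
      using T(2) unfolding two by (simp add: algebra_simps two)
    show "\<not> split_trace (2 :: 'a)" by (rule not_split_trace_2)
    show "\<not> split_trace (1 - T)"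
    proof
      assume "split_trace (1 - T)"
      then obtain r where r: "r \<noteq> 0" "r \<noteq> 1 / r" "1 - T = r + 1 / r"
        by (auto simp: split_trace_def)
      define s where "s = 1 / r"
      have rs: "r * s = 1" "1 - T = r + s" using r by (simp_all add: s_def)
      have "r ^ 2 \<noteq> 1"
        using r by (simp add: power2_eq_square nonzero_eq_divide_eq)
      \<comment> \<open>Factorisation of \<open>r ^ 8 - 1\<close>: the first factor is excluded by
        splitness, the second would give trace 0, the third a trace whose square is 2.\<close>
      have "(r ^ 2 - 1) * ((r ^ 2 + 1) * (r ^ 4 + 1)) = 0"
        using q9(3)[OF r(1)] by Groebner_Basis.algebra
      then have "r ^ 2 + 1 = 0 \<or> r ^ 4 + 1 = 0"
        using \<open>r ^ 2 \<noteq> 1\<close> by simp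
      then show False
      proof
        assume "r ^ 2 + 1 = 0"
        then have "r + s = 0" using rs by Groebner_Basis.algebra
        then show False using rs T by simp
      next
        assume "r ^ 4 + 1 = 0"
        then have "(r + s) ^ 2 = 2" using rs by Groebner_Basis.algebra
        then have "(1 - T) ^ 2 = 2" using rs by simp
        then have "2 * T = 1" using TT by (simp add: power2_diff)
        then show False using T(2) unfolding two by (simp add: minus_equation_iff[of T])
      qed
    qed
    have "2 * (T * (2 * (1 - T)) - 2 ^ 2 - (1 - T) ^ 2) \<noteq> (l - m) ^ 2"
    proof
      assume "2 * (T * (2 * (1 - T)) - 2 ^ 2 - (1 - T) ^ 2) = (l - m) ^ 2"
      moreover have "(l - m) ^ 2 = T ^ 2 - 4" using lm unfolding T_def by Groebner_Basis.algebra
      moreover have "2 * (T * (2 * (1 - T)) - 2 ^ 2 - (1 - T) ^ 2) = 8 * T - 6 * T ^ 2 - 10"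
        by (simp add: power2_eq_square algebra_simps)
      ultimately have "8 * T - 6 * T ^ 2 - 10 = T ^ 2 - 4" by (simp only:)
      then have "8 * T = 20" unfolding TT by (simp add: algebra_simps)
      moreover have "(8 :: 'a) = 3 * 3 - 1" "(20 :: 'a) = 3 * 7 - 1" by simp_all
      ultimately show False using T(1) unfolding q9(1) by simp
    qed
    then show "2 * (T * (2 * (1 - T)) - 2\<^sup>2 - (1 - T)\<^sup>2) \<noteq> (l - m)\<^sup>2 \<or> l ^ 8 \<noteq> 1" ..
  qed
qed

lemma beauville_PSL2_card_gt_7:
  assumes card: "CARD('a::{field,finite}) > 7"
  shows "\<exists>x1 y1 x2 y2. unmixed_beauville_structure (PSL2 :: ('a ^ 2 ^ 2) set monoid) x1 y1 x2 y2"
proof -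
  obtain l :: 'a where l: "primitive_root l" using ex_primitive_root by blast
  note nz = primitive_root_low_powers[OF l card]
  obtain a d where 1: "generate SL2 {mat2 l 0 0 (1 / l), mat2 a 1 (a * d - 1) d} = carrier SL2"
    "a + d = l + 1 / l" "l * a + d / l = - (l + 1 / l)"
    using generate_split_pair[OF l card] .
  obtain t t' where t: "t * t' = l + 1 / l + 2" "t \<noteq> t'"
    "2 * ((l + 1 / l) * (t * t') - t ^ 2 - t' ^ 2) \<noteq> (l - 1 / l) ^ 2 \<or> l ^ 8 \<noteq> 1"
    and ns: "\<not> split_trace t" "\<not> split_trace t'"
    using ex_nonsplit_traces[OF l card] .
  obtain x y where 2: "generate SL2 {x, y} = carrier SL2" "{x, y} \<subseteq> carrier SL2"
    "trace x = t" "trace y = t'" "trace (x ** y) = 2"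
    using generate_nonsplit_pair[OF l card t] .
  have "l \<noteq> 1 / l" using nz by (metis nonzero_eq_divide_eq square_eq_1_iff)
  then have split: "split_trace (l + 1 / l)" "split_trace (- (l + 1 / l))"
    unfolding split_trace_def using nz(1)
    by (intro exI[of _ l], simp, intro exI[of _ "- l"], simp)
  show ?thesis
  proof (rule unmixed_beauville_structure_PSL2[OF _ 1(1) 2(1)])
    show "{mat2 l 0 0 (1 / l), mat2 a 1 (a * d - 1) d, x, y} \<subseteq> carrier SL2"
      using 2(2) nz by simp
    fix u s
    assume "u \<in> {trace (mat2 l 0 0 (1 / l)), trace (mat2 a 1 (a * d - 1) d),
        trace (mat2 l 0 0 (1 / l) ** mat2 a 1 (a * d - 1) d)}"
      and "s \<in> {trace x, trace y, trace (x ** y)}"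
    then have "split_trace u" "\<not> split_trace s"
      using split ns not_split_trace_2 1(2,3) 2(3-5) by auto
    then show "trace_separated u s" by (simp add: trace_separated_def)
  qed
qed

section \<open>The field with seven elements\<close>

text \<open>A matrix with nonzero upper right entry is a product lower, upper, lower of unipotents;
  a column operation reduces the remaining matrices to this case.\<close>

lemma subgroup_eq_SL2_if_unipotents:
  fixes H :: "('a::field ^ 2 ^ 2) set"
  assumes sub: "subgroup H SL2" and up: "\<And>x. mat2 1 x 0 1 \<in> H" and lo: "\<And>x. mat2 1 0 x 1 \<in> H"
  shows "H = carrier SL2"
proof -
  have mult: "A ** B \<in> H" if "A \<in> H" "B \<in> H" for A B
    using subgroup.m_closed[OF sub that] by simp
  have gen: "mat2 p q r s \<in> H" if det: "p * s - q * r = 1" and q: "q \<noteq> 0" for p q r s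
  proof -
    define u where "u = (s - 1) / q"
    define v where "v = (p - 1) / q"
    have uv: "u * q = s - 1" "v * q = p - 1" using q by (simp_all add: u_def v_def)
    have "q * (u + (u * q + 1) * v) = q * r" using uv det by Groebner_Basis.algebra
    then have "u + (u * q + 1) * v = r" using q by simp
    moreover have "mat2 1 0 u 1 ** (mat2 1 q 0 1 ** mat2 1 0 v 1) \<in> H"
      by (intro mult up lo)
    ultimately show ?thesis using uv by (simp add: algebra_simps)
  qed
  have "A \<in> H" if A: "A \<in> carrier SL2" for A
  proof -
    obtain p q r s where Aeq: "A = mat2 p q r s" by (rule mat2_cases)
    with A have det: "p * s - q * r = 1" by simp
    show ?thesis
    proof (cases "q = 0")
      case False
      with gen det Aeq show ?thesis by simp
    next
      case True
      with det have "p \<noteq> 0" by auto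
      have "mat2 p (p + q) r (r + s) \<in> H"
        using \<open>p \<noteq> 0\<close> True det by (intro gen) (simp_all add: algebra_simps)
      from mult[OF this up[of "- 1"]] show ?thesis by (simp add: Aeq)
    qed
  qed
  then show ?thesis using subgroup.subset[OF sub] by blast
qed

lemma eq_of_nat_if_prime_card:
  fixes x :: "'a::{field,finite}"
  assumes p: "prime CARD('a)"
  obtains k where "x = of_nat k"
proof -
  have "CHAR('a) dvd CARD('a)" by (rule CHAR_dvd_CARD)
  moreover have "CHAR('a) \<noteq> 1" by simp
  ultimately have char: "CHAR('a) = CARD('a)" using p by (auto simp: prime_nat_iff)
  have "inj_on (of_nat :: nat \<Rightarrow> 'a) {..<CARD('a)}"
    by (rule inj_onI) (auto simp: of_nat_eq_iff_cong_CHAR char cong_def)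
  then have "card (of_nat ` {..<CARD('a)} :: 'a set) = CARD('a)"
    by (simp add: card_image)
  then have "of_nat ` {..<CARD('a)} = (UNIV :: 'a set)"
    by (intro card_subset_eq) auto
  then have "x \<in> of_nat ` {..<CARD('a)}" by simp
  then show ?thesis using that by blast
qed

lemma subgroup_eq_SL2_if_prime_card:
  fixes H :: "('a::{field,finite} ^ 2 ^ 2) set"
  assumes p: "prime CARD('a)" and sub: "subgroup H SL2"
    and mem: "mat2 1 1 0 1 \<in> H" "mat2 1 0 1 1 \<in> H"
  shows "H = carrier SL2"
proof (rule subgroup_eq_SL2_if_unipotents[OF sub])
  have one: "mat2 1 0 0 1 \<in> H" using subgroup.one_closed[OF sub] by (simp add: one_SL2)
  fix x :: 'a
  obtain k where x: "x = of_nat k" using eq_of_nat_if_prime_card[OF p] .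
  have "mat2 1 (of_nat n) 0 1 \<in> H" for n
    by (induction n) (use one subgroup.m_closed[OF sub mem(1)] in \<open>fastforce simp: add.commute\<close>)+
  then show "mat2 1 x 0 1 \<in> H" by (simp add: x)
  have "mat2 1 0 (of_nat n) 1 \<in> H" for n
    by (induction n) (use one subgroup.m_closed[OF sub mem(2)] in \<open>fastforce simp: add.commute\<close>)+
  then show "mat2 1 0 x 1 \<in> H" by (simp add: x)
qed

text \<open>The first triple has traces 3, 3, -3, and 5, the discriminant of
  \<open>m^2 - 3 m + 1\<close> and \<open>m^2 + 3 m + 1\<close>, is not a square modulo 7. The
  second has traces 2, 2, 1, with eigenvalues 1 and 1, respectively 3 and 5.\<close>

lemma beauville_PSL2_card_7:
  assumes card: "CARD('a::{field,finite}) = 7"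
  shows "\<exists>x1 y1 x2 y2. unmixed_beauville_structure (PSL2 :: ('a ^ 2 ^ 2) set monoid) x1 y1 x2 y2"
proof -
  interpret S: group "SL2 :: ('a ^ 2 ^ 2) monoid" by (rule group_SL2)
  have "of_nat CARD('a) = (0 :: 'a)"
    unfolding of_nat_eq_0_iff_char_dvd by (rule CHAR_dvd_CARD)
  then have 7: "(7 :: 'a) = 0" by (simp add: card)
  have mod7: "7 * x + y = y" for x y :: 'a using 7 by simp
  have nums: "(8 :: 'a) = 1" "(21 :: 'a) = 0" "(28 :: 'a) = 0" "(71 :: 'a) = 1"
    using mod7[of 1 1] mod7[of 3 0] mod7[of 4 0] mod7[of 10 1] by simp_all
  have p: "prime CARD('a)" unfolding card by simp
  let ?A = "mat2 3 (- 1) 1 0 :: 'a ^ 2 ^ 2" and ?B = "mat2 3 1 (- 1) 0 :: 'a ^ 2 ^ 2"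
  let ?U = "mat2 1 1 0 1 :: 'a ^ 2 ^ 2" and ?L = "mat2 1 0 (- 1) 1 :: 'a ^ 2 ^ 2"
  have c: "{?A, ?B, ?U, ?L} \<subseteq> carrier SL2" by simp
  have genI: "generate SL2 M = carrier SL2"
    if "M \<subseteq> carrier SL2" "?U \<in> generate SL2 M" "mat2 1 0 1 1 \<in> generate SL2 M"
    for M :: "('a ^ 2 ^ 2) set"
    using p S.generate_is_subgroup[OF that(1)] that(2,3) by (rule subgroup_eq_SL2_if_prime_card)
  have eng: "X ** Y \<in> generate SL2 M" if "X \<in> generate SL2 M" "Y \<in> generate SL2 M"
    for X Y and M :: "('a ^ 2 ^ 2) set"
    using generate.eng[OF that] by simp
  have gen1: "generate SL2 {?A, ?B} = carrier SL2"
  proof (rule genI)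
    have incl: "?A \<in> generate SL2 {?A, ?B}" "?B \<in> generate SL2 {?A, ?B}"
      by (auto intro: generate.incl)
    \<comment> \<open>By Cayley-Hamilton \<open>A^2 = 3 A - 1\<close>, so modulo 7 one has
      \<open>A^3 = A - 3 = -A^-1\<close>, and likewise for \<open>B\<close>. The two words are thus
      \<open>-B A^-1\<close> and \<open>-B^-1 A\<close>.\<close>
    have "?B ** (?A ** (?A ** ?A)) \<in> generate SL2 {?A, ?B}" by (intro eng incl)
    moreover have "?B ** (?A ** (?A ** ?A)) = ?U"
      by (simp add: nums 7)
    ultimately show "?U \<in> generate SL2 {?A, ?B}" by (simp only:)
    have "?B ** (?B ** (?B ** ?A)) \<in> generate SL2 {?A, ?B}" by (intro eng incl)
    moreover have "?B ** (?B ** (?B ** ?A)) = mat2 1 0 1 1"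
      by (simp add: nums 7)
    ultimately show "mat2 1 0 1 1 \<in> generate SL2 {?A, ?B}" by (simp only:)
  qed simp
  have gen2: "generate SL2 {?U, ?L} = carrier SL2"
  proof (rule genI)
    show "?U \<in> generate SL2 {?U, ?L}" by (auto intro: generate.incl)
    have "inv\<^bsub>SL2\<^esub> ?L \<in> generate SL2 {?U, ?L}" by (auto intro: generate.inv)
    then show "mat2 1 0 1 1 \<in> generate SL2 {?U, ?L}" by (simp add: inv_SL2)
  qed simp
  have no: "\<not> eigenvalue_trace (3 :: 'a)" "\<not> eigenvalue_trace (- 3 :: 'a)"
  proof -
    have False if m: "m \<noteq> 0" "m + 1 / m = 3 \<or> m + 1 / m = - 3" for m :: 'a
    proof -
      have m6: "m ^ 6 = 1" using power_card_minus_1[OF m(1)] card by simp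
      have "m * m + 1 = m * (m + 1 / m)" using m(1) by (simp add: distrib_left)
      then have "m * m + 1 = 3 * m \<or> m * m + 1 = - (3 * m)" using m(2) by auto
      \<comment> \<open>Reducing \<open>m ^ 6\<close> by \<open>m^2 = 3 m - 1\<close> gives
        \<open>144 m - 55\<close>, whose coefficients are Fibonacci numbers; the other sign replaces
        \<open>m\<close> by \<open>-m\<close>. Modulo 7 this leaves \<open>144 m = 0\<close>, and 2
        is inverse to 144.\<close>
      then have "144 * m = 56 \<or> 144 * m = - 56"
      proof
        assume "m * m + 1 = 3 * m"
        then show ?thesis using m6 by (intro disjI1) Groebner_Basis.algebra
      next
        assume "m * m + 1 = - (3 * m)"
        then show ?thesis using m6 by (intro disjI2) Groebner_Basis.algebra
      qed
      then have "144 * m = 0" using mod7[of 8 0] by auto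
      moreover have "2 * (144 * m) = 288 * m" by simp
      moreover have "(288 :: 'a) = 1" using mod7[of 41 1] by simp
      ultimately have "m = 0" by (metis mult_1 mult_zero_right)
      with m(1) show False ..
    qed
    then show "\<not> eigenvalue_trace (3 :: 'a)" "\<not> eigenvalue_trace (- 3 :: 'a)"
      unfolding eigenvalue_trace_def by metis+
  qed
  have yes: "eigenvalue_trace (2 :: 'a)" "eigenvalue_trace (1 :: 'a)"
  proof -
    show "eigenvalue_trace (2 :: 'a)"
      unfolding eigenvalue_trace_def by (rule exI[of _ 1]) simp
    have 15: "(3 :: 'a) * 5 = 1" using mod7[of 2 1] by simp
    then have "(3 :: 'a) \<noteq> 0" by (metis mult_zero_left zero_neq_one)
    then have "1 / (3 :: 'a) = 5" using 15 by (metis nonzero_mult_div_cancel_left)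
    moreover have "(1 :: 'a) = 3 + 5" using nums(1) by simp
    ultimately show "eigenvalue_trace (1 :: 'a)"
      unfolding eigenvalue_trace_def using \<open>(3 :: 'a) \<noteq> 0\<close> by metis
  qed
  have "trace (?A ** ?B) = - 3"
    using mod7[of 2 "- 3"] by simp
  then have "trace_separated u s"
    if "u \<in> {trace ?A, trace ?B, trace (?A ** ?B)}" "s \<in> {trace ?U, trace ?L, trace (?U ** ?L)}"
    for u s
    using that no yes unfolding trace_separated_def by (auto simp del: mat2_mult) auto
  then show ?thesis by (rule unmixed_beauville_structure_PSL2[OF c gen1 gen2])
qed

theorem theorem1p4:
  fixes p e :: nat
  assumes "prime p" and "e \<ge> 1"
    and "CARD('a::{field,finite}) = p ^ e"
    and "p ^ e \<ge> 7"
  shows "\<exists>x1 y1 x2 y2.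
    unmixed_beauville_structure (PSL2 :: ('a ^ 2 ^ 2) set monoid) x1 y1 x2 y2"
proof (cases "CARD('a) = 7")
  case True
  then show ?thesis by (rule beauville_PSL2_card_7)
next
  case False
  with assms show ?thesis by (intro beauville_PSL2_card_gt_7) simp
qed

end
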